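(* Let $\varepsilon>0$ and put $$\sigma(\varepsilon)^2=\frac{2^{-2/3}e^{-2\varepsilon/3}(1+e^{-\varepsilon})^{2/3}+e^{-\varepsilon}}{(1-e^{-\varepsilon})^2}.$$ Let $\hat f_{\mathrm{Var}}$ be any real-valued $\varepsilon$-differentially private estimator defined on datasets with records in $[0,1]$, and let $\hat f_{\mathrm{Cov}}$ be any real-valued $\varepsilon$-differentially private estimator defined on datasets with records in $[0,1]^2$, where differential privacy is with respect to either the swap model or the add-remove model. Then $$R(\hat f_{\mathrm{Cov}},\mathrm{Cov},n_0)\ \ge\ \sigma(\varepsilon)^2\,(1-o(1)),\qquad R(\hat f_{\mathrm{Var}},\mathrm{Var},n_0)\ \ge\ \sigma(\varepsilon)^2\,(1-o(1)),$$ where $o(1)\to 0$ as $n_0\to\infty$ (with $\varepsilon$ fixed). In particular, $\sigma(\varepsilon)^2\sim 2/\varepsilon^2$ as $\varepsilon\to 0$, i.e. $\varepsilon^2\sigma(\varepsilon)^2/2\to 1$.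
   Context: A dataset of size $n\ge 1$ is a finite collection (multiset) of $n$ records in $[0,1]^d$; $d=1$ for variance (records $x_i$) and $d=2$ for covariance (records $(x_i,y_i)$). A dataset is identified with its data matrix $D=[x]$ or $D=[x,y]$, and $|D|$ denotes its size. $\mathcal D_{\ge n_0}$ is the set of datasets of size at least $n_0$, and $\mathcal D^*$ is the set of datasets of all sizes $\ge 1$. $\mathrm{Var}([x])=\frac1n\sum_{i=1}^n x_i^2-\left(\frac1n\sum_{i=1}^n x_i\right)^2$ and $\mathrm{Cov}([x,y])=\frac1n\sum_{i=1}^n x_iy_i-\left(\frac1n\sum_{i=1}^n x_i\right)\left(\frac1n\sum_{i=1}^n y_i\right)$. An estimator is a randomized map $\hat f:\mathcal D^*\to\mathbb R$. It is $\varepsilon$-differentially private if $\Pr[\hat f(D)\in S]\le e^{\varepsilon}\Pr[\hat f(D')\in S]$ for all neighboring $D,D'\in\mathcal D^*$ and all measurable $S$. In the swap model, $D,D'$ are neighboring iff $|D\setminus D'|=1$ and $|D'\setminus D|=1$ (one record is replaced). In the add-remove model, $D,D'$ are neighboring iff $|D\setminus D'|+|D'\setminus D|=1$ (one record is added or removed). For a statistic $f:\mathcal D^*\to\mathbb R$: $R(\hat f,f,D)=|D|^2\,\mathbb E[(\hat f(D)-f(D))^2]$ (expectation over the randomness of $\hat f$) and $R(\hat f,f,n_0)=\sup_{D\in\mathcal D_{\ge n_0}}R(\hat f,f,D)\in[0,\infty]$. *)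

theory Defs
  imports "HOL-Probability.Probability" "HOL-Library.Multiset" "HOL-Library.Landau_Symbols"
begin

definition datasets_ge :: "'a set \<Rightarrow> nat \<Rightarrow> 'a multiset set" where
  "datasets_ge X n = {D. set_mset D \<subseteq> X \<and> n \<le> size D}"

definition datasets :: "'a set \<Rightarrow> 'a multiset set" where
  "datasets X = datasets_ge X 1"

definition dataset_var :: "real multiset \<Rightarrow> real" where
  "dataset_var D =
     (\<Sum>x\<in>#D. x\<^sup>2) / real (size D) - ((\<Sum>x\<in>#D. x) / real (size D))\<^sup>2"

definition dataset_cov :: "(real \<times> real) multiset \<Rightarrow> real" where
  "dataset_cov D =
     (\<Sum>r\<in>#D. fst r * snd r) / real (size D)
     - ((\<Sum>r\<in>#D. fst r) / real (size D)) * ((\<Sum>r\<in>#D. snd r) / real (size D))"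

definition swap_neighbors :: "'a multiset \<Rightarrow> 'a multiset \<Rightarrow> bool" where
  "swap_neighbors D D' \<longleftrightarrow> size (D - D') = 1 \<and> size (D' - D) = 1"

definition add_remove_neighbors :: "'a multiset \<Rightarrow> 'a multiset \<Rightarrow> bool" where
  "add_remove_neighbors D D' \<longleftrightarrow> size (D - D') + size (D' - D) = 1"

text \<open>
  A randomized real-valued map on datasets is represented by the law of its output:
  \<open>F D\<close> is the distribution of the estimate on input \<open>D\<close>. Values of \<open>F\<close> at multisets that
  are not datasets over \<open>X\<close> are unconstrained.
\<close>

definition estimator :: "'a set \<Rightarrow> ('a multiset \<Rightarrow> real measure) \<Rightarrow> bool" where
  "estimator X F \<longleftrightarrow> (\<forall>D\<in>datasets X. prob_space (F D) \<and> sets (F D) = sets borel)"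

definition diff_private ::
  "('a multiset \<Rightarrow> 'a multiset \<Rightarrow> bool) \<Rightarrow> real \<Rightarrow> 'a set \<Rightarrow> ('a multiset \<Rightarrow> real measure) \<Rightarrow> bool" where
  "diff_private nbr \<epsilon> X F \<longleftrightarrow>
     (\<forall>D\<in>datasets X. \<forall>D'\<in>datasets X. nbr D D' \<longrightarrow>
        (\<forall>S\<in>sets borel. measure (F D) S \<le> exp \<epsilon> * measure (F D') S))"

text \<open>The mean squared error is taken in \<open>ennreal\<close>, so that it is \<open>\<infinity>\<close> when the second moment diverges.\<close>

definition risk_at ::
  "('a multiset \<Rightarrow> real measure) \<Rightarrow> ('a multiset \<Rightarrow> real) \<Rightarrow> 'a multiset \<Rightarrow> ennreal" where
  "risk_at F f D =
     ennreal ((real (size D))\<^sup>2) * (\<integral>\<^sup>+ z. ennreal ((z - f D)\<^sup>2) \<partial>F D)"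

definition risk ::
  "'a set \<Rightarrow> ('a multiset \<Rightarrow> real measure) \<Rightarrow> ('a multiset \<Rightarrow> real) \<Rightarrow> nat \<Rightarrow> ennreal" where
  "risk X F f n0 = (SUP D\<in>datasets_ge X n0. risk_at F f D)"

definition sigma_sq :: "real \<Rightarrow> real" where
  "sigma_sq \<epsilon> =
     (2 powr (-2/3) * exp (-2 * \<epsilon> / 3) * (1 + exp (-\<epsilon>)) powr (2/3) + exp (-\<epsilon>))
     / (1 - exp (-\<epsilon>))\<^sup>2"

end

theory Submission
  imports Defs "HOL-Real_Asymp.Real_Asymp"
begin

text \<open>
  Take datasets that consist of zeros and of fewer than \<open>L\<close> copies of each record \<open>sqrt (j/N)\<close>,
  \<open>1 \<le> j \<le> N\<close>, while the number \<open>n\<close> of zeros is huge; for the covariance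
  put these records on the diagonal. Then \<open>n\<close> times the variance is almost the sum of the squared
  records, and one neighbouring step can move it by any multiple of \<open>1/N\<close> in \<open>[-1, 1]\<close>.
  Averaging the law of the rescaled error over all such datasets gives one law \<open>Q\<close> on the
  line which is nearly invariant, up to the factor \<open>e\<^sup>\<epsilon>\<close>, under all these shifts; only the datasets
  on the boundary of the box of counts contribute an error, of relative size \<open>1/L\<close>.

  That such a \<open>Q\<close> has second moment at least \<open>\<sigma>\<^sup>2\<close> is linear programming duality. With
  \<open>q = e\<^sup>-\<^sup>\<epsilon>\<close> and \<open>G x = (\<Sum>l. q\<^sup>l ((x + l)\<^sup>2 - \<sigma>\<^sup>2))\<close> we have \<open>x\<^sup>2 - \<sigma>\<^sup>2 = G x - q G (x + 1)\<close>, so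
  unit shifts reduce the claim to \<open>\<integral> G \<bar>x\<bar> dQ \<ge> 0\<close> over \<open>-1 \<le> x < 1\<close>. On \<open>[0, 1]\<close> the function \<open>G\<close> increases
  and changes sign at the breakpoint of the staircase density. There the density of \<open>Q\<close> varies
  by a factor at most \<open>e\<^sup>\<epsilon>\<close>, hence the worst case weighs the positive part of \<open>G\<close> by \<open>q\<close>, and
  \<open>\<sigma>\<^sup>2\<close> is exactly the value for which the integral so weighted vanishes.
\<close>

section \<open>Asymptotics of \<open>sigma_sq\<close> at 0\<close>

lemma sigma_sq_tendsto: "((\<lambda>\<epsilon>. \<epsilon>\<^sup>2 * sigma_sq \<epsilon> / 2) \<longlongrightarrow> 1) (at_right 0)"
proof -
  let ?a = "\<lambda>\<epsilon>::real. 2 powr (-2/3) * exp (-2 * \<epsilon> / 3) * (1 + exp (-\<epsilon>)) powr (2/3) + exp (-\<epsilon>)"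
  have "isCont ?a 0" by (intro continuous_intros) auto
  then have "(?a \<longlongrightarrow> ?a 0) (at_right 0)"
    unfolding isCont_def by (rule tendsto_mono[rotated]) (simp add: at_within_le_at)
  also have "?a 0 = 2"
    using powr_add[of "2::real" "-2/3" "2/3"] by simp
  finally have a: "(?a \<longlongrightarrow> 2) (at_right 0)" .
  have "((\<lambda>\<epsilon>::real. \<epsilon> / (1 - exp (-\<epsilon>))) \<longlongrightarrow> 1) (at_right 0)" by real_asymp
  from tendsto_mult[OF tendsto_power[OF this, of 2] tendsto_divide[OF a tendsto_const[of 2]]]
  show ?thesis by (simp add: sigma_sq_def power_divide)
qed

lemma sigma_sq_asymp_equiv: "sigma_sq \<sim>[at_right 0] (\<lambda>\<epsilon>. 2 / \<epsilon>\<^sup>2)"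
  by (rule asymp_equivI') (use sigma_sq_tendsto in \<open>simp add: mult.commute\<close>)

subsection \<open>The staircase potential\<close>

locale staircase =
  fixes \<epsilon> :: real
  assumes eps_pos: "0 < \<epsilon>"
begin

text \<open>
  \<open>K - c\<close> is the breakpoint of the staircase density, \<open>H\<close> is the antiderivative of \<open>G\<close> that
  vanishes there, and \<open>\<Phi>\<close> is the antiderivative of \<open>\<phi>\<close>.
\<close>

definition q :: real where "q = exp (- \<epsilon>)"
definition c :: real where "c = q / (1 - q)"
definition K :: real where "K = (q * (1 + q) / 2) powr (1 / 3) / (1 - q)"
definition G :: "real \<Rightarrow> real" where "G x = ((x + c)\<^sup>2 - K\<^sup>2) / (1 - q)"
definition H :: "real \<Rightarrow> real" where
  "H x = ((x + c) ^ 3 / 3 - K\<^sup>2 * (x + c) + 2 * K ^ 3 / 3) / (1 - q)"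
definition \<phi> :: "real \<Rightarrow> real" where "\<phi> x = (if x + c \<le> K then G x else q * G x)"
definition \<Phi> :: "real \<Rightarrow> real" where "\<Phi> x = (if x + c \<le> K then H x else q * H x)"
definition B :: real where "B = 2 / (1 - q) ^ 3"

section \<open>Arithmetic of the constants \<open>q\<close>, \<open>c\<close> and
  \<open>K\<close>\<close>

lemma q_bounds: "0 < q" "q < 1"
  using eps_pos by (auto simp: q_def)

lemma exp_q: "exp \<epsilon> * q = 1"
  by (simp add: q_def flip: exp_add)

lemma c_pos: "0 < c" and c_plus_one: "1 + c = 1 / (1 - q)"
  using q_bounds by (auto simp: c_def field_simps)

lemma K_pos: "0 < K"
  using q_bounds by (simp add: K_def)

lemma K_cube: "K ^ 3 = q * (1 + q) / (2 * (1 - q) ^ 3)"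
proof -
  have "((q * (1 + q) / 2) powr (1 / 3)) ^ 3 = q * (1 + q) / 2"
    using q_bounds by (simp add: powr_powr flip: powr_realpow)
  then show ?thesis by (simp only: K_def power_divide divide_divide_eq_left)
qed

text \<open>The geometric law with weights \<open>(1 - q) * q ^ l\<close> has mean \<open>c\<close>
  and variance \<open>q / (1 - q)\<^sup>2\<close>. As \<open>sigma_sq \<epsilon>\<close> is
  \<open>K\<^sup>2\<close> plus this variance, completing the square in the series of the potential
  yields the closed form \<open>G\<close>.\<close>

lemma sigma_sq_eq: "sigma_sq \<epsilon> = K\<^sup>2 + q / (1 - q)\<^sup>2"
proof -
  have "((q * (1 + q) / 2) powr (1 / 3))\<^sup>2 = (q * (1 + q) / 2) powr (2 / 3)"
    using q_bounds by (simp add: powr_powr flip: powr_realpow)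
  also have "\<dots> = q powr (2/3) * (1 + q) powr (2/3) * 2 powr (-2/3)"
    using q_bounds powr_minus_divide[of "2::real" "2/3"] by (simp only: powr_mult powr_divide) simp
  also have "q powr (2/3) = exp (-2 * \<epsilon> / 3)"
    by (simp add: q_def powr_def)
  finally have "K\<^sup>2 = exp (-2 * \<epsilon> / 3) * (1 + q) powr (2/3) * 2 powr (-2/3) / (1 - q)\<^sup>2"
    by (simp add: K_def power_divide)
  then show ?thesis
    unfolding sigma_sq_def q_def[symmetric] by (simp add: add_divide_distrib mult_ac)
qed

lemma sigma_sq_pos: "0 < sigma_sq \<epsilon>"
  unfolding sigma_sq_eq using K_pos q_bounds by (intro add_pos_pos) auto

text \<open>With \<open>K_le_one_plus_c\<close> this puts the breakpoint \<open>K - c\<close> into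
  [0, 1]. Cubes are compared, the 2 in the rule standing for the exponent \<open>Suc 2\<close>, and
  \<open>q\<^sup>2 \<le> (1 + q) / 2\<close> remains.\<close>

lemma c_le_K: "c \<le> K"
proof (rule power_le_imp_le_base[of _ 2])
  have "q\<^sup>2 \<le> q" using q_bounds by (simp add: power2_eq_square)
  then have "q\<^sup>2 \<le> (1 + q) / 2" using q_bounds by simp
  then have "q * q\<^sup>2 \<le> q * ((1 + q) / 2)" using q_bounds by (intro mult_left_mono) auto
  then have "q ^ 3 / (1 - q) ^ 3 \<le> (q * ((1 + q) / 2)) / (1 - q) ^ 3"
    using q_bounds by (intro divide_right_mono) (auto simp: power3_eq_cube power2_eq_square)
  then show "c ^ Suc 2 \<le> K ^ Suc 2"
    using K_cube by (simp add: c_def power_divide numeral_3_eq_3[symmetric])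
qed (use K_pos in auto)

lemma K_le_one_plus_c: "K \<le> 1 + c"
proof (rule power_le_imp_le_base[of _ 2])
  have "q * (1 + q) \<le> 1 * 2" using q_bounds by (intro mult_mono) auto
  then have "(q * (1 + q) / 2) / (1 - q) ^ 3 \<le> 1 / (1 - q) ^ 3"
    using q_bounds by (intro divide_right_mono) auto
  then show "K ^ Suc 2 \<le> (1 + c) ^ Suc 2"
    using K_cube unfolding c_plus_one by (simp add: power_divide numeral_3_eq_3[symmetric])
qed (use c_pos in auto)

text \<open>Splitting off the term \<open>l = 0\<close> of the geometric series leaves
  \<open>q\<close> times the series at \<open>x + 1\<close>. For the closed form this comes down to
  \<open>c = q * (1 + c)\<close> and \<open>q / (1 - q)\<^sup>2 = (1 + c) * c\<close>.\<close>

lemma G_recurrence: "G x - q * G (x + 1) = x\<^sup>2 - sigma_sq \<epsilon>"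
proof -
  have "(1 - q) * G y = (y + c)\<^sup>2 - K\<^sup>2" for y
    using q_bounds by (simp add: G_def)
  from this[of x] this[of "x + 1"]
  have "(1 - q) * (G x - q * G (x + 1)) = ((x + c)\<^sup>2 - K\<^sup>2) - q * ((x + 1 + c)\<^sup>2 - K\<^sup>2)"
    by algebra
  also have "\<dots> = (1 - q) * (x\<^sup>2 - sigma_sq \<epsilon>)"
  proof -
    have e: "c * (1 - q) = q" "c = q * (1 + c)"
      using q_bounds by (auto simp: c_def field_simps)
    have "q / (1 - q)\<^sup>2 = (1 + c) * c"
      using q_bounds unfolding c_plus_one by (simp add: c_def power2_eq_square)
    then show ?thesis unfolding sigma_sq_eq using e by algebra
  qed
  finally show ?thesis using q_bounds by simp
qed

section \<open>Sign, monotonicity and growth of \<open>G\<close>\<close>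

lemma G_mono: "0 \<le> x \<Longrightarrow> x \<le> y \<Longrightarrow> G x \<le> G y"
  unfolding G_def using q_bounds c_pos by (intro divide_right_mono diff_right_mono power_mono) auto

lemma G_nonneg_iff: "0 \<le> x \<Longrightarrow> 0 \<le> G x \<longleftrightarrow> K \<le> x + c"
  unfolding G_def using q_bounds c_pos K_pos by (simp add: zero_le_divide_iff abs_le_square_iff[symmetric])

lemma G_nonpos_iff: "0 \<le> x \<Longrightarrow> G x \<le> 0 \<longleftrightarrow> x + c \<le> K"
  unfolding G_def using q_bounds c_pos K_pos
  by (simp add: divide_le_0_iff abs_le_square_iff[symmetric])

lemma G_nonneg: "1 \<le> x \<Longrightarrow> 0 \<le> G x"
  using G_nonneg_iff[of x] K_le_one_plus_c by simp

lemma B_pos: "0 < B"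
  using q_bounds by (simp add: B_def)

text \<open>Growth like \<open>1 + x\<^sup>2\<close> lets the second moment control the error of a
  shift. By \<open>c_plus_one\<close> the constant \<open>B\<close> is
  \<open>2 * (1 + c)\<^sup>2 / (1 - q)\<close>.\<close>

lemma G_shift_le: "0 \<le> x \<Longrightarrow> G (x + 1) \<le> B * (1 + x\<^sup>2)"
proof -
  assume x: "0 \<le> x"
  have "(x + 1 + c)\<^sup>2 \<le> 2 * x\<^sup>2 + 2 * (1 + c)\<^sup>2"
    using sum_squares_bound[of x "1 + c"] by (simp add: power2_sum algebra_simps)
  also have "\<dots> \<le> 2 * (1 + c)\<^sup>2 * (1 + x\<^sup>2)"
    using mult_right_mono[of 1 "(1 + c)\<^sup>2" "x\<^sup>2"] c_pos by (simp add: algebra_simps)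
  finally have "G (x + 1) \<le> 2 * (1 + c)\<^sup>2 * (1 + x\<^sup>2) / (1 - q)"
    unfolding G_def using q_bounds zero_le_power2[of K] by (intro divide_right_mono) linarith+
  also have "\<dots> = B * (1 + x\<^sup>2)"
    unfolding c_plus_one B_def by (simp add: power_divide power3_eq_cube power2_eq_square)
  finally show ?thesis .
qed

lemma abs_G_le: "0 \<le> x \<Longrightarrow> x \<le> 1 \<Longrightarrow> \<bar>G x\<bar> \<le> B"
proof -
  assume x: "0 \<le> x" "x \<le> 1"
  have "(x + c)\<^sup>2 \<le> (1 + c)\<^sup>2" "K\<^sup>2 \<le> (1 + c)\<^sup>2"
    using x c_pos K_pos K_le_one_plus_c by (auto intro!: power_mono)
  then have "\<bar>(x + c)\<^sup>2 - K\<^sup>2\<bar> \<le> 2 * (1 + c)\<^sup>2"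
    using zero_le_power2[of K] zero_le_power2[of "x + c"] by linarith
  then have "\<bar>G x\<bar> \<le> 2 * (1 + c)\<^sup>2 / (1 - q)"
    unfolding G_def using q_bounds by (simp add: abs_divide divide_right_mono)
  also have "\<dots> = B"
    unfolding c_plus_one B_def by (simp add: power_divide power3_eq_cube power2_eq_square)
  finally show ?thesis .
qed

text \<open>A mean value bound for the increasing derivative \<open>G\<close>, obtained without
  calculus: for \<open>u = x + c\<close> and \<open>v = y + c\<close> the gap is
  \<open>(v - u)\<^sup>2 * (2 * v + u) / (3 * (1 - q))\<close>.\<close>

lemma H_diff_le: "0 \<le> x \<Longrightarrow> x \<le> y \<Longrightarrow> H y - H x \<le> G y * (y - x)"
proof -
  assume xy: "0 \<le> x" "x \<le> y"
  define u v where "u = x + c" and "v = y + c"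
  have uv: "0 \<le> u" "u \<le> v" using xy c_pos by (auto simp: u_def v_def)
  have "3 * (v\<^sup>2 * (v - u)) - (v ^ 3 - u ^ 3) = (v - u)\<^sup>2 * (2 * v + u)"
    by (simp add: power2_eq_square power3_eq_cube algebra_simps)
  also have "\<dots> \<ge> 0" using uv by simp
  finally have "(v ^ 3 - u ^ 3) / 3 \<le> v\<^sup>2 * (v - u)"
    by (simp only: diff_ge_0_iff_ge pos_divide_le_eq zero_less_numeral mult.commute)
  then have "(v ^ 3 - u ^ 3) / 3 - K\<^sup>2 * (v - u) \<le> (v\<^sup>2 - K\<^sup>2) * (v - u)"
    unfolding left_diff_distrib by linarith
  then have "((v ^ 3 - u ^ 3) / 3 - K\<^sup>2 * (v - u)) / (1 - q) \<le> (v\<^sup>2 - K\<^sup>2) * (v - u) / (1 - q)"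
    using q_bounds by (intro divide_right_mono) auto
  then show ?thesis
    unfolding H_def G_def u_def v_def by (simp add: diff_divide_distrib add_divide_distrib algebra_simps)
qed

lemma H_K: "H (K - c) = 0"
  by (simp add: H_def power2_eq_square power3_eq_cube)

lemma G_K: "G (K - c) = 0"
  by (simp add: G_def)

text \<open>The bound survives the change of branch because \<open>H\<close> and \<open>G\<close>
  both vanish at \<open>K - c\<close>. An interval across the breakpoint is split there; its left
  part contributes at most 0.\<close>

lemma \<Phi>_diff_le: "0 \<le> x \<Longrightarrow> x \<le> y \<Longrightarrow> \<Phi> y - \<Phi> x \<le> \<phi> y * (y - x)"
proof -
  assume xy: "0 \<le> x" "x \<le> y"
  consider "y + c \<le> K" | "x + c \<le> K" "K < y + c" | "K < x + c" using xy by linarith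
  then show ?thesis
  proof cases
    case 1 then show ?thesis using xy H_diff_le[of x y] by (simp add: \<Phi>_def \<phi>_def)
  next
    case 2
    have "q * H y \<le> q * (G y * (y - (K - c)))"
      using H_diff_le[of "K - c" y] 2 c_le_K q_bounds by (simp add: H_K)
    also have "\<dots> \<le> q * (G y * (y - x))"
      using 2 q_bounds xy G_nonneg_iff[of y] by (intro mult_left_mono) auto
    finally show ?thesis
      using 2 H_diff_le[of x "K - c"] xy by (simp add: \<Phi>_def \<phi>_def H_K G_K)
  next
    case 3 then show ?thesis
      using xy mult_left_mono[OF H_diff_le[of x y], of q] q_bounds
      by (simp add: \<Phi>_def \<phi>_def algebra_simps)
  qed
qed

text \<open>This equation determines \<open>K\<close>. With \<open>t = 1 + c\<close> and
  \<open>c = q * t\<close> the terms in \<open>K\<^sup>2\<close> cancel from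
  \<open>q * H 1 = H 0\<close>, and what is left is the value of \<open>K ^ 3\<close>.\<close>

lemma \<Phi>_balance: "\<Phi> 1 = \<Phi> 0"
proof -
  have k: "2 * (1 - q) * K ^ 3 = q * (1 + q) * (1 + c)\<^sup>2"
  proof -
    have "2 * p * (r / (2 * p ^ 3)) = r * (1 / p)\<^sup>2" if "p \<noteq> 0" for p r :: real
      using that by (simp add: field_simps power3_eq_cube power2_eq_square)
    from this[of "1 - q"] show ?thesis unfolding K_cube c_plus_one using q_bounds by fastforce
  qed
  define t where "t = 1 + c"
  have t: "(1 - q) * t = 1" "c = q * t"
    using q_bounds unfolding t_def c_plus_one by (auto simp: c_def)
  have "q * (t ^ 3 - 3 * K\<^sup>2 * t + 2 * K ^ 3) - (c ^ 3 - 3 * K\<^sup>2 * c + 2 * K ^ 3)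
      = q * (1 + q) * t\<^sup>2 * ((1 - q) * t) - 2 * (1 - q) * K ^ 3"
    unfolding t(2) by (simp add: algebra_simps power2_eq_square power3_eq_cube)
  also have "\<dots> = 0" unfolding t(1) k by (simp add: t_def)
  finally have "q * ((1 + c) ^ 3 / 3 - K\<^sup>2 * (1 + c) + 2 * K ^ 3 / 3) = c ^ 3 / 3 - K\<^sup>2 * c + 2 * K ^ 3 / 3"
    by (simp add: t_def right_diff_distrib distrib_left)
  then have "q * H 1 = H 0" by (simp add: H_def field_simps)
  moreover have "\<Phi> 1 = q * H 1"
  proof (cases "1 + c = K")
    case True
    then have "K - c = 1" by simp
    then show ?thesis using H_K by (simp add: \<Phi>_def)
  qed (use K_le_one_plus_c in \<open>simp add: \<Phi>_def\<close>)
  ultimately show ?thesis using c_le_K by (simp add: \<Phi>_def)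
qed

text \<open>A right Riemann sum of the increasing function \<^term>\<open>\<phi>\<close> exceeds its integral \<open>\<Phi> 1 - \<Phi> 0 = 0\<close>.\<close>

lemma sum_\<phi>_ge:
  assumes "0 < N"
  shows "(\<Sum>j<N. \<phi> (real j / real N)) \<ge> - (2 * B)"
proof -
  let ?x = "\<lambda>j. real j / real N"
  have "0 = (\<Sum>j<N. \<Phi> (?x (Suc j)) - \<Phi> (?x j))"
    using assms sum_lessThan_telescope[of "\<lambda>j. \<Phi> (?x j)" N] by (simp only:) (simp add: \<Phi>_balance)
  also have "\<dots> \<le> (\<Sum>j<N. \<phi> (?x (Suc j)) * (?x (Suc j) - ?x j))"
    by (intro sum_mono \<Phi>_diff_le) (auto simp: divide_right_mono)
  also have "\<dots> = (\<Sum>j<N. \<phi> (?x (Suc j))) / N"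
    by (simp add: sum_divide_distrib diff_divide_distrib add_divide_distrib)
  finally have "0 \<le> (\<Sum>j<N. \<phi> (?x (Suc j)))"
    using assms by (simp add: zero_le_divide_iff)
  \<comment> \<open>Right endpoints are traded for left ones at the price of the two end values,
    each bounded by \<open>B\<close>.\<close>
  moreover have "(\<Sum>j<N. \<phi> (?x (Suc j))) - (\<Sum>j<N. \<phi> (?x j)) = \<phi> (?x N) - \<phi> (?x 0)"
    using sum_lessThan_telescope[of "\<lambda>j. \<phi> (?x j)" N] by (simp add: sum_subtractf)
  moreover have "\<bar>\<phi> x\<bar> \<le> B" if "0 \<le> x" "x \<le> 1" for x
  proof -
    have "\<bar>q * G x\<bar> \<le> \<bar>G x\<bar>" using q_bounds by (simp add: abs_mult mult_left_le_one_le)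
    then show ?thesis using abs_G_le[OF that] by (auto simp: \<phi>_def)
  qed
  from this[of 0] this[of 1] have "\<phi> (?x N) - \<phi> (?x 0) \<le> 2 * B" using assms by simp
  ultimately show ?thesis by linarith
qed

text \<open>Let \<open>m\<close> be the least \<open>b j\<close>. Where \<open>G\<close> is
  positive, \<open>b j \<ge> m\<close> is used; elsewhere
  \<open>b j \<le> exp \<epsilon> * m + \<kappa>\<close>. As \<open>exp \<epsilon> * q = 1\<close>,
  both cases give the term \<open>exp \<epsilon> * m * \<phi>\<close> up to
  \<open>B * \<kappa>\<close>, and \<open>m \<le> 1 / N\<close> makes the Riemann error
  small.\<close>

lemma sum_G_ge:
  fixes b :: "nat \<Rightarrow> real"
  assumes N: "0 < N" and b0: "\<And>j. j < N \<Longrightarrow> 0 \<le> b j" and b1: "(\<Sum>j<N. b j) \<le> 1"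
    and le: "\<And>i j. i < N \<Longrightarrow> j < N \<Longrightarrow> b j \<le> exp \<epsilon> * b i + \<kappa>" and \<kappa>: "0 \<le> \<kappa>"
  shows "(\<Sum>j<N. G (real j / real N) * b j) \<ge> - (2 * B * exp \<epsilon> / real N + B * real N * \<kappa>)"
proof -
  define m where "m = Min (b ` {..<N})"
  have "m \<in> b ` {..<N}" unfolding m_def using N by (intro Min_in) auto
  then obtain i where i: "i < N" "m = b i" by auto
  have m: "m \<le> b j" if "j < N" for j using that by (simp add: m_def)
  have "real N * m \<le> 1" using sum_bounded_below[of "{..<N}" m b] m b1 by simp
  then have mN: "m \<le> 1 / N" using N by (simp add: field_simps)
  have m0: "0 \<le> m" using i b0 by simp
  have "G (j / N) * b j \<ge> exp \<epsilon> * m * \<phi> (j / N) - B * \<kappa>" if j: "j < N" for j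
  proof (cases "j / N + c \<le> K")
    case True
    then have G: "G (j / N) \<le> 0" by (simp add: G_nonpos_iff)
    have "\<bar>G (j / N)\<bar> * \<kappa> \<le> B * \<kappa>" using j \<kappa> by (intro mult_right_mono abs_G_le) auto
    moreover have "G (j / N) * (exp \<epsilon> * m + \<kappa>) \<le> G (j / N) * b j"
      using le[OF i(1) j] i(2) G by (intro mult_left_mono_neg) auto
    ultimately show ?thesis using True G by (simp add: \<phi>_def algebra_simps)
  next
    case False
    then have "0 \<le> G (j / N)" by (simp add: G_nonneg_iff)
    then have "G (j / N) * m \<le> G (j / N) * b j" using m[OF j] by (intro mult_left_mono) auto
    moreover have "exp \<epsilon> * m * \<phi> (j / N) = (exp \<epsilon> * q) * (G (j / N) * m)"
      using False by (simp add: \<phi>_def)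
    moreover have "0 \<le> B * \<kappa>" using \<kappa> B_pos by simp
    ultimately show ?thesis unfolding exp_q by linarith
  qed
  then have "(\<Sum>j<N. exp \<epsilon> * m * \<phi> (j / N) - B * \<kappa>) \<le> (\<Sum>j<N. G (j / N) * b j)"
    by (intro sum_mono) auto
  moreover have "(\<Sum>j<N. exp \<epsilon> * m * \<phi> (j / N) - B * \<kappa>)
      = exp \<epsilon> * m * (\<Sum>j<N. \<phi> (j / N)) - B * N * \<kappa>"
    by (simp add: sum_subtractf sum_distrib_left)
  moreover have "exp \<epsilon> * m * (\<Sum>j<N. \<phi> (j / N)) \<ge> exp \<epsilon> * m * (- (2 * B))"
    using sum_\<phi>_ge[OF N] m0 by (intro mult_left_mono) auto
  moreover have "exp \<epsilon> * m * (2 * B) \<le> exp \<epsilon> * (1 / N) * (2 * B)"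
    using mN B_pos by (intro mult_right_mono mult_left_mono) auto
  ultimately show ?thesis by (simp add: algebra_simps)
qed

end

subsection \<open>Laws nearly invariant under shifts\<close>

text \<open>The cells tile [-1, 1). All are closed on the left, so that translations by multiples of
  \<open>1 / N\<close> carry cells to cells; on the negative side the index is therefore a ceiling
  minus 1.\<close>

lemma sum_cells:
  fixes a :: "nat \<Rightarrow> real"
  assumes "0 < N"
  shows "(\<Sum>j<N. a j * (indicator {real j / N..<(real j + 1) / N} x
                       + indicator {- (real j + 1) / N..<- real j / N} x))
    = (if 0 \<le> x \<and> x < 1 then a (nat \<lfloor>x * N\<rfloor>)
       else if -1 \<le> x \<and> x < 0 then a (nat (\<lceil>- x * N\<rceil> - 1)) else 0)" (is "?l = ?r")
proof -
  have i1: "indicator {real j / N..<(real j + 1) / N} x = (if 0 \<le> x \<and> j = nat \<lfloor>x * N\<rfloor> then 1 else (0::real))" for j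
  proof -
    have "x \<in> {real j / N..<(real j + 1) / N} \<longleftrightarrow> \<lfloor>x * N\<rfloor> = int j"
      using assms by (auto simp: floor_eq_iff field_simps)
    moreover have "\<lfloor>x * N\<rfloor> = int j \<longleftrightarrow> 0 \<le> x \<and> j = nat \<lfloor>x * N\<rfloor>"
    proof -
      have "0 \<le> \<lfloor>x * N\<rfloor> \<longleftrightarrow> 0 \<le> x"
        using assms by (simp add: zero_le_mult_iff)
      then show ?thesis by linarith
    qed
    ultimately show ?thesis by (simp add: indicator_def)
  qed
  have i2: "indicator {- (real j + 1) / N..<- real j / N} x = (if x < 0 \<and> j = nat (\<lceil>- x * N\<rceil> - 1) then 1 else (0::real))" for j
  proof -
    have "x \<in> {- (real j + 1) / N..<- real j / N} \<longleftrightarrow> \<lceil>- x * N\<rceil> = int j + 1"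
      using assms by (auto simp: ceiling_eq_iff field_simps)
    moreover have "\<lceil>- x * N\<rceil> = int j + 1 \<longleftrightarrow> x < 0 \<and> j = nat (\<lceil>- x * N\<rceil> - 1)"
    proof -
      have "\<lceil>- x * N\<rceil> \<ge> 1 \<longleftrightarrow> x < 0"
        using assms by (simp add: one_le_ceiling mult_less_0_iff)
      then show ?thesis by linarith
    qed
    ultimately show ?thesis by (simp add: indicator_def)
  qed
  have "nat \<lfloor>x * N\<rfloor> < N \<longleftrightarrow> x < 1" if "0 \<le> x"
    using that assms by (simp add: nat_less_iff floor_less_iff field_simps)
  moreover have "nat (\<lceil>- x * N\<rceil> - 1) < N \<longleftrightarrow> -1 \<le> x" if "x < 0"
  proof -
    have "nat (\<lceil>- x * N\<rceil> - 1) < N \<longleftrightarrow> \<lceil>- x * N\<rceil> \<le> int N"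
      using assms by auto
    also have "\<dots> \<longleftrightarrow> - x * N \<le> 1 * real N" by (simp add: ceiling_le_iff)
    also have "\<dots> \<longleftrightarrow> - x \<le> 1" using assms by (intro mult_le_cancel_right_pos) auto
    finally show ?thesis by auto
  qed
  moreover have "?l = (\<Sum>j<N. if j = nat \<lfloor>x * N\<rfloor> then (if 0 \<le> x then a j else 0) else 0)
             + (\<Sum>j<N. if j = nat (\<lceil>- x * N\<rceil> - 1) then (if x < 0 then a j else 0) else 0)"
    unfolding i1 i2 sum.distrib[symmetric] by (intro sum.cong) auto
  ultimately show ?thesis by (auto simp: sum.delta)
qed

context staircase
begin

text \<open>On each cell the step function takes the value of \<open>G\<close> at the end nearest to
  0, and \<open>G\<close> increases on the nonnegative reals.\<close>

lemma sum_cells_G_le: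
  assumes "0 < N"
  shows "(\<Sum>j<N. G (real j / N) * (indicator {real j / N..<(real j + 1) / N} x
             + indicator {- (real j + 1) / N..<- real j / N} x))
         \<le> G \<bar>x\<bar> * indicator {-1..<1} x"
proof -
  have "real (nat \<lfloor>x * N\<rfloor>) / N \<le> x" if "0 \<le> x"
    using that assms by (simp add: field_simps)
  moreover have "real (nat (\<lceil>- x * N\<rceil> - 1)) / N \<le> - x" if "x < 0"
  proof -
    have "0 < - x * N" using that assms by (simp add: mult_less_0_iff)
    then have "real (nat (\<lceil>- x * N\<rceil> - 1)) = of_int \<lceil>- x * N\<rceil> - 1" by simp
    also have "\<dots> \<le> - x * N" using ceiling_correct[of "- x * N"] by linarith
    finally show ?thesis using assms by (simp add: field_simps)
  qed
  ultimately show ?thesis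
    unfolding sum_cells[OF assms] using G_mono by (auto simp: indicator_def)
qed

text \<open>The duality argument. In \<open>shift\<close>, a translate dominated by
  \<open>b * (1 + x\<^sup>2)\<close> costs the factor \<open>exp \<epsilon>\<close> and an additive
  \<open>b * \<kappa>\<close>. Unit shifts handle \<open>G\<close> outside [-1, 1), shifts by
  multiples of \<open>1 / N\<close> compare the cells inside.\<close>

lemma second_moment_ge:
  fixes Q :: "real measure"
  assumes "prob_space Q" and sets: "sets Q = sets borel" and int2: "integrable Q (\<lambda>x. x\<^sup>2)"
    and N: "0 < N" and \<kappa>: "0 \<le> \<kappa>"
    and shift: "\<And>h b i. \<bar>i\<bar> \<le> int N \<Longrightarrow> integrable Q h \<Longrightarrow> (\<And>x. 0 \<le> h x) \<Longrightarrow> 0 \<le> b \<Longrightarrow>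
        (\<And>x. h (x + of_int i / N) \<le> b * (1 + x\<^sup>2)) \<Longrightarrow>
        (\<integral>x. h (x + of_int i / N) \<partial>Q) \<le> exp \<epsilon> * (\<integral>x. h x \<partial>Q) + b * \<kappa>"
  shows "(\<integral>x. x\<^sup>2 \<partial>Q) \<ge> sigma_sq \<epsilon> - (2 * B * exp \<epsilon> / N + 2 * B * (real N + 1) * \<kappa>)"
proof -
  interpret prob_space Q by fact
  have [measurable_cong]: "sets Q = sets borel" by fact
  have bnd: "integrable Q f"
    if "f \<in> borel_measurable borel" "\<And>x. \<bar>f x\<bar> \<le> b * (1 + x\<^sup>2)" for f :: "real \<Rightarrow> real" and b
  proof (rule Bochner_Integration.integrable_bound)
    show "integrable Q (\<lambda>x. b * (1 + x\<^sup>2))"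
      using int2 by (intro integrable_mult_right Bochner_Integration.integrable_add) auto
    show "AE x in Q. norm (f x) \<le> norm (b * (1 + x\<^sup>2))"
    proof (intro AE_I2)
      show "norm (f x) \<le> norm (b * (1 + x\<^sup>2))" for x using that(2)[of x] by simp
    qed
  qed (use that(1) in measurable)
  have G_meas[measurable]: "G \<in> borel_measurable borel" unfolding G_def[abs_def] by measurable
  \<comment> \<open>The choice of closed and open ends makes exactly one of
    \<open>hp (x + 1)\<close> and \<open>hm (x - 1)\<close> live at every \<open>x\<close>, so that
    their sum is \<open>G (\<bar>x\<bar> + 1)\<close>.\<close>
  define hp where "hp x = G x * indicator {1..} x" for x :: real
  define hm where "hm x = G (- x) * indicator {..<-1} x" for x :: real
  have [measurable]: "hp \<in> borel_measurable borel" "hm \<in> borel_measurable borel"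
    unfolding hp_def[abs_def] hm_def[abs_def] by measurable
  have h0: "0 \<le> hp x" "0 \<le> hm x" for x
    using G_nonneg[of x] G_nonneg[of "- x"] by (auto simp: hp_def hm_def indicator_def)
  have GB: "G x \<le> B * (1 + x\<^sup>2)" if "0 \<le> x" for x
    using G_mono[of x "x + 1"] G_shift_le[of x] that by simp
  have hB: "hp x \<le> B * (1 + x\<^sup>2)" "hm x \<le> B * (1 + x\<^sup>2)"
    "hp (x + 1) \<le> B * (1 + x\<^sup>2)" "hm (x - 1) \<le> B * (1 + x\<^sup>2)" for x
    using GB[of x] GB[of "- x"] G_shift_le[of x] G_shift_le[of "- x"] B_pos
    by (auto simp: hp_def hm_def indicator_def add_ac)
  have int_h: "integrable Q hp" "integrable Q hm" "integrable Q (\<lambda>x. hp (x + 1))" "integrable Q (\<lambda>x. hm (x - 1))"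
    by ((rule bnd[of _ B], measurable, simp add: h0 hB)+)
  have int_G: "integrable Q (\<lambda>x. G \<bar>x\<bar>)"
  proof (rule bnd[of _ B])
    show "\<bar>G \<bar>x\<bar>\<bar> \<le> B * (1 + x\<^sup>2)" for x
    proof (cases "\<bar>x\<bar> \<le> 1")
      case True
      have "B \<le> B * (1 + x\<^sup>2)" using B_pos by simp
      then show ?thesis using abs_G_le[of "\<bar>x\<bar>"] True by simp
    next
      case False
      then show ?thesis using GB[of "\<bar>x\<bar>"] G_nonneg[of "\<bar>x\<bar>"] by simp
    qed
  qed measurable
  define cell where "cell j x = indicator {real j / N..<(real j + 1) / N} x
      + (indicator {- (real j + 1) / N..<- real j / N} x :: real)" for j and x :: real
  have [measurable]: "cell j \<in> borel_measurable borel" for j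
    unfolding cell_def[abs_def] by measurable
  define b where "b j = (\<integral>x. cell j x \<partial>Q)" for j
  have cell0: "0 \<le> cell j x" for j x by (simp add: cell_def)
  have int_cell: "integrable Q (cell j)" for j
    unfolding cell_def[abs_def] by (intro Bochner_Integration.integrable_add; simp add: emeasure_eq_measure)
  have "(\<Sum>j<N. b j) = (\<integral>x. (\<Sum>j<N. 1 * cell j x) \<partial>Q)"
    unfolding b_def using int_cell by (subst Bochner_Integration.integral_sum) auto
  also have "\<dots> \<le> (\<integral>x. 1 \<partial>Q)"
  proof (rule integral_mono)
    show "(\<Sum>j<N. 1 * cell j x) \<le> 1" for x
      unfolding cell_def sum_cells[OF N] by auto
  qed (use int_cell in auto)
  also have "\<dots> = 1" by (simp add: prob_space)
  finally have b1: "(\<Sum>j<N. b j) \<le> 1" .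
  have b_le: "b j \<le> exp \<epsilon> * b i + 2 * \<kappa>" if ij: "i < N" "j < N" for i j
  proof -
    define C where "C k = {real k / N..<(real k + 1) / N}" for k
    define C' where "C' k = {- (real k + 1) / N..<- real k / N}" for k
    have C_iff: "x \<in> C k \<longleftrightarrow> real k \<le> x * N \<and> x * N < real k + 1" for k x
      using N by (simp add: C_def field_simps)
    have C'_iff: "x \<in> C' k \<longleftrightarrow> - (real k + 1) \<le> x * N \<and> x * N < - real k" for k x
      using N by (simp add: C'_def field_simps)
    have [simp]: "(x + r / N) * N = x * N + r" for x r :: real
      using N by (simp add: distrib_right)
    \<comment> \<open>The two halves of a pair of cells move in opposite directions; each is a shift
      with \<open>b = 1\<close>, whence the error \<open>2 * \<kappa>\<close>.\<close>
    have C: "indicator (C i) (x + of_int (int i - int j) / N) = (indicator (C j) x :: real)" for x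
      by (auto simp: C_iff indicator_def)
    have C': "indicator (C' i) (x + of_int (int j - int i) / N) = (indicator (C' j) x :: real)" for x
      by (auto simp: C'_iff indicator_def)
    have int_C: "integrable Q (indicator (C k) :: real \<Rightarrow> real)" "integrable Q (indicator (C' k) :: real \<Rightarrow> real)" for k
      by (auto simp: C_def C'_def emeasure_eq_measure)
    have "(\<integral>x. indicator (C j) x \<partial>Q) \<le> exp \<epsilon> * (\<integral>x. indicator (C i) x \<partial>Q) + 1 * \<kappa>"
      using shift[of "int i - int j" "indicator (C i)" 1] ij int_C unfolding C
      by (auto simp: indicator_def)
    moreover have "(\<integral>x. indicator (C' j) x \<partial>Q) \<le> exp \<epsilon> * (\<integral>x. indicator (C' i) x \<partial>Q) + 1 * \<kappa>"
      using shift[of "int j - int i" "indicator (C' i)" 1] ij int_C unfolding C'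
      by (auto simp: indicator_def)
    moreover have "b k = (\<integral>x. indicator (C k) x \<partial>Q) + (\<integral>x. indicator (C' k) x \<partial>Q)" for k
      unfolding b_def cell_def C_def[symmetric] C'_def[symmetric]
      by (rule Bochner_Integration.integral_add) (rule int_C)+
    ultimately show ?thesis by (simp add: algebra_simps)
  qed
  have "- (2 * B * exp \<epsilon> / N + B * N * (2 * \<kappa>)) \<le> (\<Sum>j<N. G (real j / N) * b j)"
    by (rule sum_G_ge) (use N b1 b_le \<kappa> cell0 in \<open>auto simp: b_def\<close>)
  also have "\<dots> = (\<integral>x. (\<Sum>j<N. G (real j / N) * cell j x) \<partial>Q)"
    unfolding b_def using int_cell by (subst Bochner_Integration.integral_sum) auto
  \<comment> \<open>Subtracting \<open>hp\<close> and \<open>hm\<close> cuts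
    \<open>G \<bar>x\<bar>\<close> off to [-1, 1), where the cells live.\<close>
  also have "\<dots> \<le> (\<integral>x. G \<bar>x\<bar> - hp x - hm x \<partial>Q)"
  proof (rule integral_mono)
    show "(\<Sum>j<N. G (real j / N) * cell j x) \<le> G \<bar>x\<bar> - hp x - hm x" for x
      using sum_cells_G_le[OF N, of x] by (auto simp: cell_def hp_def hm_def indicator_def split: if_splits)
  qed (auto intro!: int_cell int_G int_h)
  also have "\<dots> = (\<integral>x. G \<bar>x\<bar> \<partial>Q) - (\<integral>x. hp x \<partial>Q) - (\<integral>x. hm x \<partial>Q)"
    using int_G int_h by simp
  finally have 1: "(\<integral>x. hp x \<partial>Q) + (\<integral>x. hm x \<partial>Q) - (2 * B * exp \<epsilon> / N + B * N * (2 * \<kappa>)) \<le> (\<integral>x. G \<bar>x\<bar> \<partial>Q)"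
    by linarith
  \<comment> \<open>The shifts \<open>i = N\<close> and \<open>i = - N\<close> are the unit shifts;
    multiplication by \<open>q\<close> then cancels \<open>exp \<epsilon>\<close>.\<close>
  have "(\<integral>x. hp (x + 1) \<partial>Q) \<le> exp \<epsilon> * (\<integral>x. hp x \<partial>Q) + B * \<kappa>"
    using shift[of "int N" hp B] N int_h h0 hB B_pos by simp
  moreover have "(\<integral>x. hm (x - 1) \<partial>Q) \<le> exp \<epsilon> * (\<integral>x. hm x \<partial>Q) + B * \<kappa>"
    using shift[of "- int N" hm B] N int_h h0 hB B_pos by simp
  ultimately have "q * ((\<integral>x. hp (x + 1) \<partial>Q) + (\<integral>x. hm (x - 1) \<partial>Q))
      \<le> q * (exp \<epsilon> * ((\<integral>x. hp x \<partial>Q) + (\<integral>x. hm x \<partial>Q)) + 2 * (B * \<kappa>))"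
    using q_bounds by (intro mult_left_mono) (auto simp: algebra_simps)
  also have "\<dots> = (exp \<epsilon> * q) * ((\<integral>x. hp x \<partial>Q) + (\<integral>x. hm x \<partial>Q)) + q * (2 * (B * \<kappa>))"
    by (simp add: algebra_simps)
  also have "\<dots> \<le> (\<integral>x. hp x \<partial>Q) + (\<integral>x. hm x \<partial>Q) + 2 * (B * \<kappa>)"
    using mult_right_mono[of q 1 "2 * (B * \<kappa>)"] q_bounds B_pos \<kappa> unfolding exp_q by simp
  finally have 2: "q * ((\<integral>x. hp (x + 1) \<partial>Q) + (\<integral>x. hm (x - 1) \<partial>Q))
      \<le> (\<integral>x. hp x \<partial>Q) + (\<integral>x. hm x \<partial>Q) + 2 * (B * \<kappa>)" .
  have "(\<integral>x. x\<^sup>2 \<partial>Q) - sigma_sq \<epsilon> = (\<integral>x. x\<^sup>2 - sigma_sq \<epsilon> \<partial>Q)"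
    using int2 by (simp add: prob_space)
  also have "\<dots> = (\<integral>x. G \<bar>x\<bar> - q * (hp (x + 1) + hm (x - 1)) \<partial>Q)"
  proof (rule Bochner_Integration.integral_cong[OF refl])
    fix x
    have "hp (x + 1) + hm (x - 1) = G (\<bar>x\<bar> + 1)"
      by (auto simp: hp_def hm_def indicator_def add_ac)
    then show "x\<^sup>2 - sigma_sq \<epsilon> = G \<bar>x\<bar> - q * (hp (x + 1) + hm (x - 1))"
      using G_recurrence[of "\<bar>x\<bar>"] by simp
  qed
  also have "\<dots> = (\<integral>x. G \<bar>x\<bar> \<partial>Q) - q * ((\<integral>x. hp (x + 1) \<partial>Q) + (\<integral>x. hm (x - 1) \<partial>Q))"
    using int_G int_h by simp
  finally show ?thesis using 1 2 by (simp add: algebra_simps)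
qed

end

subsection \<open>Averaging over boxes of counts\<close>

text \<open>The setwise inequality says that \<open>M\<close> lies below
  \<open>scale_measure r N\<close> in the order of measures, and integrals are monotone in the
  measure.\<close>

lemma nn_integral_le_of_measure_le:
  fixes M N :: "'a measure"
  assumes "finite_measure M" "finite_measure N" "sets M = sets N" "0 \<le> r"
    and "\<And>S. S \<in> sets M \<Longrightarrow> measure M S \<le> r * measure N S"
    and f: "f \<in> borel_measurable N"
  shows "(\<integral>\<^sup>+x. f x \<partial>M) \<le> ennreal r * (\<integral>\<^sup>+x. f x \<partial>N)"
proof -
  interpret M: finite_measure M by fact
  interpret N: finite_measure N by fact
  have "emeasure M S \<le> ennreal r * emeasure N S" for S
    using assms(3-5) by (cases "S \<in> sets M")
      (auto simp: M.emeasure_eq_measure N.emeasure_eq_measure measure_notin_sets simp flip: ennreal_mult intro!: ennreal_leI)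
  then have "M \<le> scale_measure (ennreal r) N"
    using assms(3) sets_eq_imp_space_eq[OF assms(3)] by (simp add: le_measure_iff le_fun_def space_scale_measure)
  then have "(\<integral>\<^sup>+x. f x \<partial>M) \<le> (\<integral>\<^sup>+x. f x \<partial>scale_measure (ennreal r) N)"
    using assms(3) by (intro nn_integral_mono_measure) auto
  also have "\<dots> = ennreal r * (\<integral>\<^sup>+x. f x \<partial>N)" by (rule nn_integral_scale_measure[OF f])
  finally show ?thesis .
qed

text \<open>\<open>k j\<close> is the number of copies of the \<open>j\<close>-th record.
  Extensional functions keep the box finite.\<close>

definition count_box :: "nat \<Rightarrow> nat \<Rightarrow> (nat \<Rightarrow> nat) set" where
  "count_box N L = {1..N} \<rightarrow>\<^sub>E {..<L}"

definition weight :: "nat \<Rightarrow> (nat \<Rightarrow> nat) \<Rightarrow> real" where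
  "weight N k = (\<Sum>j=1..N. real j * real (k j)) / N"

lemma finite_box: "finite (count_box N L)"
  by (auto simp: count_box_def intro!: finite_PiE)

lemma box_nonempty: "0 < L \<Longrightarrow> count_box N L \<noteq> {}"
  by (auto simp: count_box_def PiE_eq_empty_iff)

lemma box_update: "k \<in> count_box N L \<Longrightarrow> j \<in> {1..N} \<Longrightarrow> v < L \<Longrightarrow> k(j := v) \<in> count_box N L"
  by (auto simp: count_box_def PiE_iff extensional_def)

lemma weight_update:
  assumes "j \<in> {1..N}"
  shows "weight N (k(j := v)) = weight N k + real j * (real v - real (k j)) / N"
proof -
  have "(\<Sum>i=1..N. real i * real ((k(j := v)) i)) = real j * real v + (\<Sum>i\<in>{1..N} - {j}. real i * real (k i))"
    using assms by (subst sum.remove[of _ j]) (auto intro!: sum.cong)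
  moreover have "(\<Sum>i=1..N. real i * real (k i)) = real j * real (k j) + (\<Sum>i\<in>{1..N} - {j}. real i * real (k i))"
    using assms by (subst sum.remove[of _ j]) auto
  ultimately show ?thesis
    by (simp add: weight_def field_simps add_divide_distrib[symmetric] diff_divide_distrib[symmetric])
qed

text \<open>Overwriting coordinate \<open>j\<close> by every \<open>v < L\<close> spreads the slice
  injectively over the box. This is the source of the boundary error \<open>1 / L\<close>.\<close>

lemma card_box_slice:
  assumes "j \<in> {1..N}"
  shows "card {k \<in> count_box N L. k j = a} * L \<le> card (count_box N L)"
proof -
  have "card ({k \<in> count_box N L. k j = a} \<times> {..<L}) \<le> card (count_box N L)"
  proof (rule card_inj_on_le[of "\<lambda>(k, v). k(j := v)"])
    show "inj_on (\<lambda>(k, v). k(j := v)) ({k \<in> count_box N L. k j = a} \<times> {..<L})"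
      by (rule inj_onI) (auto simp: fun_eq_iff split: if_splits, metis)
  qed (use assms box_update finite_box in auto)
  then show ?thesis by (simp add: card_cartesian_product)
qed

text \<open>On \<open>C0\<close> the step \<open>T\<close> stays inside \<open>C\<close> and the sum
  is reindexed; every other index is charged the crude bound \<open>W\<close>.\<close>

lemma sum_shift_le:
  fixes I J :: "'i \<Rightarrow> ennreal"
  assumes C: "finite C" "C0 \<subseteq> C" and T: "inj_on T C0" "T ` C0 \<subseteq> C"
    and le: "\<And>k. k \<in> C0 \<Longrightarrow> I k \<le> e * J (T k)" and W: "\<And>k. k \<in> C \<Longrightarrow> I k \<le> W"
  shows "(\<Sum>k\<in>C. I k) \<le> e * (\<Sum>k\<in>C. J k) + of_nat (card (C - C0)) * W"
proof -
  have "(\<Sum>k\<in>C. I k) = (\<Sum>k\<in>C0. I k) + (\<Sum>k\<in>C - C0. I k)"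
    using sum.subset_diff[OF C(2,1), of I] by (simp add: add.commute)
  also have "\<dots> \<le> (\<Sum>k\<in>C0. e * J (T k)) + (\<Sum>k\<in>C - C0. W)"
    using le W by (intro add_mono sum_mono) auto
  also have "(\<Sum>k\<in>C0. e * J (T k)) = e * (\<Sum>k\<in>T ` C0. J k)"
    using T by (simp add: sum.reindex sum_distrib_left)
  also have "(\<Sum>k\<in>T ` C0. J k) \<le> (\<Sum>k\<in>C. J k)"
    using T C by (intro sum_mono2) auto
  finally show ?thesis by (simp add: mult_left_mono)
qed

section \<open>Uniform mixtures of laws on the line\<close>

context
  fixes C :: "'i set" and M :: "'i \<Rightarrow> real measure"
  assumes C: "finite C" "C \<noteq> {}" and M: "\<And>k. prob_space (M k)" "\<And>k. sets (M k) = sets borel"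
begin

definition mixture :: "real measure" where
  "mixture = measure_pmf (pmf_of_set C) \<bind> M"

text \<open>On a discrete space only the range matters for measurability; this is why
  \<open>M k\<close> is a law for every \<open>k\<close> and not just for
  \<open>k \<in> C\<close>.\<close>

lemma kernel: "M \<in> measurable (measure_pmf (pmf_of_set C)) (subprob_algebra borel)"
  using M by (auto simp: space_subprob_algebra prob_space_imp_subprob_space)

lemma prob_space_mixture: "prob_space mixture"
  unfolding mixture_def
  by (rule measure_pmf.prob_space_bind[OF _ kernel]) (simp add: M)

lemma sets_mixture: "sets mixture = sets borel"
  unfolding mixture_def by (rule sets_bind) (auto simp: M)

lemma nn_integral_mixture:
  assumes "f \<in> borel_measurable borel"
  shows "(\<integral>\<^sup>+x. f x \<partial>mixture) = (\<Sum>k\<in>C. \<integral>\<^sup>+x. f x \<partial>M k) / of_nat (card C)"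
  unfolding mixture_def
  by (subst nn_integral_bind[OF assms kernel]) (rule nn_integral_pmf_of_set[OF C(2,1)])

end

context staircase
begin

text \<open>One more copy of record \<open>j\<close> raises the weight by \<open>j / N\<close>, so
  shifting the centred output \<open>\<alpha> * z - weight N k\<close> by \<open>i / N\<close> is
  one neighbouring step in coordinate \<open>\<bar>i\<bar>\<close>. The average \<open>Q\<close>
  over the box thus satisfies \<open>shift\<close> with
  \<open>\<kappa> = (1 + V) / L\<close>.\<close>

lemma family_bound:
  fixes P :: "(nat \<Rightarrow> nat) \<Rightarrow> real measure" and \<alpha> :: real
  assumes N: "0 < N" and L: "0 < L" and V: "0 \<le> V"
    and prob: "\<And>k. prob_space (P k)" and sets: "\<And>k. sets (P k) = sets borel"
    and privacy: "\<And>k j S. k \<in> count_box N L \<Longrightarrow> j \<in> {1..N} \<Longrightarrow> Suc (k j) < L \<Longrightarrow> S \<in> sets borel \<Longrightarrow>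
        measure (P k) S \<le> exp \<epsilon> * measure (P (k(j := Suc (k j)))) S \<and>
        measure (P (k(j := Suc (k j)))) S \<le> exp \<epsilon> * measure (P k) S"
    and var: "\<And>k. k \<in> count_box N L \<Longrightarrow> (\<integral>\<^sup>+z. ennreal ((\<alpha> * z - weight N k)\<^sup>2) \<partial>P k) \<le> ennreal V"
  shows "sigma_sq \<epsilon> - (2 * B * exp \<epsilon> / N + 2 * B * (real N + 1) * ((1 + V) / L)) \<le> V"
proof -
  define M where "M k = distr (P k) borel (\<lambda>z. \<alpha> * z - weight N k)" for k
  have Mp: "prob_space (M k)" and Ms: "sets (M k) = sets borel" for k
  proof -
    interpret prob_space "P k" by (rule prob)
    have [measurable_cong]: "sets (P k) = sets borel" by (rule sets)
    show "prob_space (M k)" unfolding M_def by (rule prob_space_distr) measurable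
  qed (simp add: M_def)
  have nn_M: "(\<integral>\<^sup>+x. f x \<partial>M k) = (\<integral>\<^sup>+z. f (\<alpha> * z - weight N k) \<partial>P k)" if "f \<in> borel_measurable borel" for f k
  proof -
    have [measurable_cong]: "sets (P k) = sets borel" by (rule sets)
    show ?thesis unfolding M_def using that by (subst nn_integral_distr) auto
  qed
  let ?C = "count_box N L"
  note fin = finite_box[of N L] box_nonempty[OF L, of N]
  define K where "K = card ?C"
  have K: "0 < K" using fin by (simp add: K_def card_gt_0_iff)
  define Q where "Q = mixture ?C M"
  have Qp: "prob_space Q" and Qs: "sets Q = sets borel"
    using prob_space_mixture[of ?C M] sets_mixture[of ?C M] fin Mp Ms by (auto simp: Q_def)
  interpret Q: prob_space Q by (rule Qp)
  have [measurable_cong]: "sets Q = sets borel" by (rule Qs)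
  have nn_Q: "(\<integral>\<^sup>+x. f x \<partial>Q) = (\<Sum>k\<in>?C. \<integral>\<^sup>+x. f x \<partial>M k) / of_nat K" if "f \<in> borel_measurable borel" for f
    unfolding Q_def K_def using nn_integral_mixture[of ?C M f] fin Mp Ms that by auto
  have var_M: "(\<integral>\<^sup>+x. ennreal (x\<^sup>2) \<partial>M k) \<le> ennreal V" if "k \<in> ?C" for k
    using var[OF that] by (simp add: nn_M)
  have avg_le: "(\<Sum>k\<in>?C. I k) / of_nat K \<le> W" if "\<And>k. k \<in> ?C \<Longrightarrow> I k \<le> W" for I :: "_ \<Rightarrow> ennreal" and W
  proof -
    have "(\<Sum>k\<in>?C. I k) \<le> of_nat K * W" unfolding K_def using that by (rule sum_bounded_above)
    then have "(\<Sum>k\<in>?C. I k) / of_nat K \<le> (of_nat K * W) / of_nat K" by (rule divide_right_mono_ennreal)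
    also have "\<dots> = W" using K
      by (simp add: ennreal_mult_divide_eq mult.commute)
    finally show ?thesis .
  qed
  have var_Q: "(\<integral>\<^sup>+x. ennreal (x\<^sup>2) \<partial>Q) \<le> ennreal V"
    using avg_le[of "\<lambda>k. \<integral>\<^sup>+x. ennreal (x\<^sup>2) \<partial>M k", OF var_M] by (simp add: nn_Q)
  have int2: "integrable Q (\<lambda>x. x\<^sup>2)"
    using var_Q by (intro integrableI_bounded) (auto simp: le_less_trans)
  have shift: "(\<integral>x. h (x + of_int i / N) \<partial>Q) \<le> exp \<epsilon> * (\<integral>x. h x \<partial>Q) + b * ((1 + V) / L)"
    if i: "\<bar>i\<bar> \<le> int N" and int_h: "integrable Q h" and h0: "\<And>x. 0 \<le> h x" and b0: "0 \<le> b"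
      and hb: "\<And>x. h (x + of_int i / N) \<le> b * (1 + x\<^sup>2)" for h b i
  proof (cases "i = 0")
    case True
    \<comment> \<open>Coordinates start at 1, so the zero shift is no step between datasets;
      \<open>exp \<epsilon> \<ge> 1\<close> suffices.\<close>
    have "1 * (\<integral>x. h x \<partial>Q) \<le> exp \<epsilon> * (\<integral>x. h x \<partial>Q)"
      using eps_pos h0 by (intro mult_right_mono integral_nonneg_AE) auto
    then show ?thesis using True b0 V by (simp add: add_increasing2)
  next
    case False
    define d where "d = of_int i / real N"
    have [measurable]: "h \<in> borel_measurable borel"
      using borel_measurable_integrable[OF int_h] by simp
    define j where "j = nat \<bar>i\<bar>"
    have j: "j \<in> {1..N}" using i False by (auto simp: j_def)
    \<comment> \<open>Adding \<open>i / N\<close> to the error means lowering the weight by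
      \<open>i / N\<close>: one copy is removed if \<open>i > 0\<close> and added if
      \<open>i < 0\<close>. The set \<open>C0\<close> excludes the face of the box where this would
      leave it.\<close>
    define T where "T k = (if 0 < i then k(j := k j - 1) else k(j := Suc (k j)))" for k :: "nat \<Rightarrow> nat"
    define C0 where "C0 = {k \<in> ?C. if 0 < i then k j \<noteq> 0 else k j \<noteq> L - 1}"
    have below: "k j < L" if "k \<in> ?C" for k
      using that j by (auto simp: count_box_def PiE_iff)
    have "(\<Sum>k\<in>?C. \<integral>\<^sup>+x. ennreal (h (x + d)) \<partial>M k)
        \<le> ennreal (exp \<epsilon>) * (\<Sum>k\<in>?C. \<integral>\<^sup>+x. ennreal (h x) \<partial>M k) + of_nat (card (?C - C0)) * ennreal (b * (1 + V))"
    proof (rule sum_shift_le[of "count_box N L" C0 T "\<lambda>k. \<integral>\<^sup>+x. ennreal (h (x + d)) \<partial>M k"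
          "ennreal (exp \<epsilon>)" "\<lambda>k. \<integral>\<^sup>+x. ennreal (h x) \<partial>M k" "ennreal (b * (1 + V))"])
      show "inj_on T C0"
      proof (rule inj_onI, rule ext)
        fix k k' n assume k: "k \<in> C0" "k' \<in> C0" and "T k = T k'"
        then have "T k n = T k' n" by simp
        then show "k n = k' n"
          using k by (auto simp: T_def C0_def split: if_splits)
      qed
      show "T ` C0 \<subseteq> ?C"
      proof
        fix k' assume "k' \<in> T ` C0"
        then obtain k where k: "k \<in> C0" "k' = T k" by blast
        then have "k j < L" "k \<in> ?C" by (auto simp: C0_def below)
        with k j show "k' \<in> ?C" by (auto simp: T_def C0_def intro!: box_update)
      qed
      fix k assume k: "k \<in> C0"
      then have kC: "k \<in> ?C" "k j < L" by (auto simp: C0_def below)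
      have wT: "\<alpha> * z - weight N k + d = \<alpha> * z - weight N (T k)" for z
      proof -
        have "real j = (if 0 < i then of_int i else - of_int i)" by (simp add: j_def)
        then show ?thesis using k by (auto simp: T_def C0_def weight_update[OF j] d_def of_nat_diff)
      qed
      have le: "measure (P k) S \<le> exp \<epsilon> * measure (P (T k)) S" if "S \<in> sets borel" for S
      proof (cases "0 < i")
        case True
        \<comment> \<open>As \<open>privacy\<close> speaks of increments, a removal is read
          backwards from the smaller count vector.\<close>
        define k' where "k' = k(j := k j - 1)"
        have "k'(j := Suc (k' j)) = k" using k True by (auto simp: k'_def C0_def)
        moreover have "k' \<in> ?C" unfolding k'_def using kC j by (intro box_update) auto
        moreover have "Suc (k' j) < L" using kC k True by (auto simp: k'_def C0_def)
        ultimately show ?thesis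
          using privacy[of k' j S] that j True by (simp add: T_def k'_def)
      next
        case False
        then show ?thesis using privacy[of k j S] k kC j that by (auto simp: T_def C0_def)
      qed
      have [measurable_cong]: "sets (P k) = sets borel" for k by (rule sets)
      show "(\<integral>\<^sup>+x. ennreal (h (x + d)) \<partial>M k) \<le> ennreal (exp \<epsilon>) * (\<integral>\<^sup>+x. ennreal (h x) \<partial>M (T k))"
        using nn_integral_le_of_measure_le[of "P k" "P (T k)" "exp \<epsilon>" "\<lambda>z. ennreal (h (\<alpha> * z - weight N (T k)))"]
          prob_space.finite_measure[OF prob] le
        by (simp add: nn_M wT sets)
    next
      fix k assume k: "k \<in> ?C"
      interpret Mk: prob_space "M k" by (rule Mp)
      have [measurable_cong]: "sets (M k) = sets borel" by (rule Ms)
      have "(\<integral>\<^sup>+x. ennreal (h (x + d)) \<partial>M k) \<le> (\<integral>\<^sup>+x. ennreal b * (1 + ennreal (x\<^sup>2)) \<partial>M k)"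
      proof (rule nn_integral_mono)
        fix x
        have "ennreal (h (x + d)) \<le> ennreal (b * (1 + x\<^sup>2))"
          unfolding d_def by (rule ennreal_leI[OF hb])
        then show "ennreal (h (x + d)) \<le> ennreal b * (1 + ennreal (x\<^sup>2))"
          using b0 by (simp add: ennreal_mult)
      qed
      also have "\<dots> = ennreal b * (1 + (\<integral>\<^sup>+x. ennreal (x\<^sup>2) \<partial>M k))"
        by (simp add: nn_integral_cmult nn_integral_add Mk.emeasure_space_1)
      also have "\<dots> \<le> ennreal b * (1 + ennreal V)"
        using var_M[OF k] by (intro mult_left_mono add_mono) auto
      also have "\<dots> = ennreal (b * (1 + V))"
        using b0 V by (simp add: ennreal_mult)
      finally show "(\<integral>\<^sup>+x. ennreal (h (x + d)) \<partial>M k) \<le> ennreal (b * (1 + V))" .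
    qed (auto simp: C0_def fin)
    then have "(\<integral>\<^sup>+x. ennreal (h (x + d)) \<partial>Q)
        \<le> (ennreal (exp \<epsilon>) * (\<Sum>k\<in>?C. \<integral>\<^sup>+x. ennreal (h x) \<partial>M k) + of_nat (card (?C - C0)) * ennreal (b * (1 + V))) / of_nat K"
      by (simp add: nn_Q divide_right_mono_ennreal)
    also have "\<dots> = ennreal (exp \<epsilon>) * (\<integral>\<^sup>+x. ennreal (h x) \<partial>Q) + of_nat (card (?C - C0)) * ennreal (b * (1 + V)) / of_nat K"
      by (simp add: nn_Q add_divide_distrib_ennreal ennreal_times_divide)
    also have "of_nat (card (?C - C0)) * ennreal (b * (1 + V)) / of_nat K \<le> ennreal (b * ((1 + V) / L))"
    proof -
      have "?C - C0 = {k \<in> ?C. k j = (if 0 < i then 0 else L - 1)}" by (auto simp: C0_def)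
      then have "card (?C - C0) * L \<le> K" using card_box_slice[OF j] by (simp add: K_def)
      then have "real (card (?C - C0)) * real L \<le> real K" by (metis of_nat_le_iff of_nat_mult)
      then have "real (card (?C - C0)) / K \<le> 1 / L" using K L by (simp add: field_simps)
      then have "real (card (?C - C0)) / K * (b * (1 + V)) \<le> 1 / L * (b * (1 + V))"
        using b0 V by (intro mult_right_mono) auto
      then have "ennreal (real (card (?C - C0)) * (b * (1 + V)) / real K) \<le> ennreal (b * ((1 + V) / L))"
        by (intro ennreal_leI) (simp add: field_simps)
      then show ?thesis using K b0 V
        by (simp add: ennreal_of_nat_eq_real_of_nat divide_ennreal flip: ennreal_mult)
    qed
    also have "(\<integral>\<^sup>+x. ennreal (h x) \<partial>Q) = ennreal (\<integral>x. h x \<partial>Q)"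
      using int_h h0 by (intro nn_integral_eq_integral) auto
    finally have "(\<integral>\<^sup>+x. ennreal (h (x + d)) \<partial>Q) \<le> ennreal (exp \<epsilon> * (\<integral>x. h x \<partial>Q) + b * ((1 + V) / L))"
      using b0 V h0 by (simp add: ennreal_mult ennreal_plus add_left_mono)
    moreover have "(\<integral>x. h (x + d) \<partial>Q) = enn2real (\<integral>\<^sup>+x. ennreal (h (x + d)) \<partial>Q)"
      using h0 by (intro integral_eq_nn_integral) auto
    ultimately show ?thesis
      unfolding d_def[symmetric] using b0 V h0
      by (auto intro!: enn2real_leI add_nonneg_nonneg mult_nonneg_nonneg integral_nonneg_AE)
  qed
  have "sigma_sq \<epsilon> - (2 * B * exp \<epsilon> / N + 2 * B * (real N + 1) * ((1 + V) / L)) \<le> (\<integral>x. x\<^sup>2 \<partial>Q)"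
    by (rule second_moment_ge[OF Qp Qs int2 N _ shift]) (use V in auto)
  also have "\<dots> \<le> V"
  proof -
    have "ennreal (\<integral>x. x\<^sup>2 \<partial>Q) = (\<integral>\<^sup>+x. ennreal (x\<^sup>2) \<partial>Q)"
      using int2 by (intro nn_integral_eq_integral[symmetric]) auto
    then have "ennreal (\<integral>x. x\<^sup>2 \<partial>Q) \<le> ennreal V" using var_Q by (rule ord_eq_le_trans)
    then show ?thesis using V by (simp only: ennreal_le_iff)
  qed
  finally show ?thesis .
qed

end

subsection \<open>Datasets with prescribed counts\<close>

text \<open>Square roots place the squared records on the grid \<open>j / N\<close>.\<close>

definition profile :: "nat \<Rightarrow> (nat \<Rightarrow> nat) \<Rightarrow> real multiset" where
  "profile N k = (\<Sum>j=1..N. replicate_mset (k j) (sqrt (real j / N)))"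

lemma sum_mset_profile:
  "(\<Sum>x\<in>#profile N k. g x) = (\<Sum>j=1..N. real (k j) * g (sqrt (real j / N)))" for g :: "real \<Rightarrow> real"
proof -
  have "(\<Sum>x\<in>#(\<Sum>j\<in>J. replicate_mset (k j) (sqrt (real j / N))). g x) = (\<Sum>j\<in>J. real (k j) * g (sqrt (real j / N)))"
    if "finite J" for J using that by (induction J) auto
  then show ?thesis by (simp add: profile_def)
qed

lemma size_profile: "real (size (profile N k)) = (\<Sum>j=1..N. real (k j))"
  using sum_mset_profile[of "\<lambda>_. 1" N k] by simp

lemma set_mset_profile: "set_mset (profile N k) \<subseteq> {0..1}"
proof -
  have "set_mset (\<Sum>j\<in>J. replicate_mset (k j) (sqrt (real j / N))) \<subseteq> {0..1}"
    if "finite J" "J \<subseteq> {1..N}" for J using that by (induction J) auto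
  then show ?thesis by (simp add: profile_def)
qed

lemma profile_update:
  assumes "j \<in> {1..N}"
  shows "profile N (k(j := Suc (k j))) = add_mset (sqrt (real j / N)) (profile N k)"
proof -
  have "(\<Sum>i\<in>{1..N} - {j}. replicate_mset ((k(j := Suc (k j))) i) (sqrt (real i / N)))
      = (\<Sum>i\<in>{1..N} - {j}. replicate_mset (k i) (sqrt (real i / N)))"
    by (intro sum.cong) auto
  then show ?thesis
    using assms by (simp add: profile_def sum.remove[of _ j])
qed

lemma sum_sq_profile: "(\<Sum>x\<in>#profile N k. x\<^sup>2) = weight N k"
  by (simp add: sum_mset_profile weight_def sum_divide_distrib mult.commute)

lemma size_profile_le:
  assumes "k \<in> count_box N L"
  shows "size (profile N k) \<le> N * L"
proof -
  have "(\<Sum>j=1..N. real (k j)) \<le> (\<Sum>j=1..N. real L)"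
    using assms by (intro sum_mono) (force simp: count_box_def PiE_iff)
  then have "real (size (profile N k)) \<le> real (N * L)" by (simp add: size_profile)
  then show ?thesis by (simp only: of_nat_le_iff)
qed

lemma sum_profile_bounds:
  "0 \<le> (\<Sum>x\<in>#profile N k. x)" "(\<Sum>x\<in>#profile N k. x) \<le> size (profile N k)"
  "0 \<le> weight N k" "weight N k \<le> size (profile N k)"
proof -
  show "0 \<le> (\<Sum>x\<in>#profile N k. x)" "0 \<le> weight N k"
    unfolding sum_mset_profile weight_def by (auto intro!: sum_nonneg divide_nonneg_nonneg)
  have "real (k j) * sqrt (real j / N) \<le> real (k j)" "real j * real (k j) / N \<le> real (k j)" if "j \<in> {1..N}" for j
    using that by (auto intro!: mult_left_le mult_right_mono simp: field_simps)
  then show "(\<Sum>x\<in>#profile N k. x) \<le> size (profile N k)" "weight N k \<le> size (profile N k)"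
    unfolding sum_mset_profile size_profile weight_def sum_divide_distrib by (auto intro!: sum_mono)
qed

text \<open>With \<open>r\<close> records in all and sum \<open>s\<close>, the difference is
  \<open>w * ((r - n) / r) + (n / r) * (s\<^sup>2 / r)\<close>, two nonnegative terms of size at
  most \<open>R\<^sup>2 / n\<close>. The range allowed for \<open>r\<close> covers both a fixed
  total \<open>n\<close> and a fixed number \<open>n\<close> of zeros.\<close>

lemma dataset_var_profile:
  assumes n: "0 < n" and m: "n \<le> size (profile N k) + z" "size (profile N k) + z \<le> n + R"
    and R: "size (profile N k) \<le> R"
  shows "\<bar>real n * dataset_var (profile N k + replicate_mset z 0) - weight N k\<bar> \<le> 2 * (real R)\<^sup>2 / n"
proof -
  define w s r where "w = weight N k" and "s = (\<Sum>x\<in>#profile N k. x)" and "r = real (size (profile N k) + z)"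
  have rn: "real n \<le> r" "r \<le> real n + real R" "0 < real n"
    using m n of_nat_mono[OF m(1), where 'a = real] of_nat_mono[OF m(2), where 'a = real]
    by (auto simp: r_def)
  have w: "0 \<le> w" "w \<le> R" and s: "0 \<le> s" "s \<le> R"
    using sum_profile_bounds[where N = N and k = k] of_nat_mono[OF R, where 'a = real] by (auto simp: w_def s_def)
  have "(\<Sum>x\<in>#profile N k + replicate_mset z 0. x\<^sup>2) = w"
    "(\<Sum>x\<in>#profile N k + replicate_mset z 0. x) = s"
    "real (size (profile N k + replicate_mset z 0)) = r"
    using sum_sq_profile[of N k] by (simp_all add: w_def s_def r_def)
  then have "dataset_var (profile N k + replicate_mset z 0) = w / r - (s / r)\<^sup>2"
    unfolding dataset_var_def by simp
  then have "w - real n * dataset_var (profile N k + replicate_mset z 0) = w * ((r - n) / r) + (n / r) * (s\<^sup>2 / r)"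
    using rn by (simp only:) (simp add: field_simps power2_eq_square)
  moreover have "0 \<le> w * ((r - n) / r) + (n / r) * (s\<^sup>2 / r)"
    using rn w by (auto intro!: add_nonneg_nonneg mult_nonneg_nonneg divide_nonneg_pos)
  moreover have "w * ((r - n) / r) \<le> R * (R / n)"
    using rn w by (intro mult_mono frac_le divide_nonneg_pos) auto
  moreover have "(n / r) * (s\<^sup>2 / r) \<le> 1 * (R\<^sup>2 / n)"
    using rn s by (intro mult_mono frac_le power_mono) auto
  ultimately have "\<bar>w - real n * dataset_var (profile N k + replicate_mset z 0)\<bar> \<le> R * (R / n) + 1 * (R\<^sup>2 / n)"
    by linarith
  then show ?thesis by (simp add: w_def power2_eq_square abs_minus_commute)
qed

lemma swap_neighbors_add: "a \<noteq> b \<Longrightarrow> swap_neighbors (add_mset a D) (add_mset b D)"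
  by (simp add: swap_neighbors_def)

lemma add_remove_neighbors_add:
  "add_remove_neighbors (add_mset a D) D" "add_remove_neighbors D (add_mset a D)"
  by (simp_all add: add_remove_neighbors_def)

text \<open>At \<open>n\<close> take the least \<open>1 / (k + 1)\<close> with
  \<open>k \<le> n\<close> for which \<open>P n\<close> holds; \<open>k = 0\<close> always
  qualifies, and each fixed \<open>k\<close> does so eventually.\<close>

lemma ex_rate:
  fixes P :: "nat \<Rightarrow> real \<Rightarrow> bool"
  assumes one: "\<And>n. P n 1" and ev: "\<And>\<eta>. 0 < \<eta> \<Longrightarrow> \<eta> \<le> 1 \<Longrightarrow> \<forall>\<^sub>F n in sequentially. P n \<eta>"
  shows "\<exists>\<delta>. \<delta> \<longlonglongrightarrow> 0 \<and> (\<forall>n. P n (\<delta> n))"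
proof -
  define S where "S n = {k. k \<le> n \<and> P n (inverse (Suc k))}" for n
  define \<delta> where "\<delta> n = inverse (real (Suc (Max (S n))))" for n
  have S: "finite (S n)" "0 \<in> S n" for n
    using one by (auto simp: S_def)
  have "Max (S n) \<in> S n" for n using S[of n] by (intro Max_in) auto
  then have "P n (\<delta> n)" for n unfolding \<delta>_def by (auto simp: S_def)
  moreover have "\<delta> \<longlonglongrightarrow> 0"
  proof (rule LIMSEQ_I)
    fix r :: real assume "0 < r"
    then obtain k where k: "inverse (real (Suc k)) < r" using reals_Archimedean by blast
    have "\<forall>\<^sub>F n in sequentially. P n (inverse (real (Suc k)))"
      by (rule ev) (auto simp: field_simps)
    then obtain n1 where n1: "\<And>n. n \<ge> n1 \<Longrightarrow> P n (inverse (real (Suc k)))"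
      by (auto simp: eventually_sequentially)
    have "norm (\<delta> n - 0) < r" if "max n1 k \<le> n" for n
    proof -
      have "k \<in> S n" using that n1[of n] by (simp add: S_def)
      then have "k \<le> Max (S n)" using S by simp
      then have "\<delta> n \<le> inverse (real (Suc k))" unfolding \<delta>_def by (intro le_imp_inverse_le) auto
      moreover have "0 \<le> \<delta> n" by (simp add: \<delta>_def)
      ultimately show ?thesis using k by simp
    qed
    then show "\<exists>n0. \<forall>n\<ge>n0. norm (\<delta> n - 0) < r" by blast
  qed
  ultimately show ?thesis by blast
qed

lemma dataset_cov_diagonal: "dataset_cov (image_mset (\<lambda>x. (x, x)) D) = dataset_var D"
  by (simp add: dataset_cov_def dataset_var_def power2_eq_square image_mset.compositionality comp_def)

section \<open>From the averaged law to the risk\<close>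

context staircase
begin

text \<open>By contradiction: a smaller risk bounds all second moments by \<open>V\<close>, which
  \<open>family_bound\<close> forbids. The embedding \<open>e\<close> serves both statistics, as the
  identity for the variance and as the diagonal for the covariance.\<close>

lemma eventually_risk_ge:
  fixes e :: "real \<Rightarrow> 'r"
  assumes e: "inj e" "e ` {0..1} \<subseteq> X" and f: "\<And>D. f (image_mset e D) = dataset_var D"
    and \<eta>: "0 < \<eta>" "\<eta> \<le> 1"
  shows "\<forall>\<^sub>F n in sequentially. \<forall>nbr\<in>{swap_neighbors, add_remove_neighbors}. \<forall>F.
      estimator X F \<longrightarrow> diff_private nbr \<epsilon> X F \<longrightarrow> ennreal (sigma_sq \<epsilon> * (1 - \<eta>)) \<le> risk X F f n"
proof -
  define \<sigma> where "\<sigma> = sigma_sq \<epsilon>"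
  have \<sigma>: "0 < \<sigma>" using sigma_sq_pos by (simp add: \<sigma>_def)
  \<comment> \<open>Half of the slack \<open>\<eta>\<close> absorbs the replacement of the variance
    by the weight; the other half exceeds the grid and boundary errors, each below
    \<open>\<sigma> * \<eta> / 8\<close>. Here \<open>\<sigma>\<close> denotes the squared
    constant.\<close>
  define V where "V = \<sigma> * (1 - \<eta> / 2)"
  have V: "0 \<le> V" "V \<le> \<sigma>" using \<sigma> \<eta> by (auto simp: V_def algebra_simps)
  have s\<eta>: "0 < \<sigma> * \<eta> / 8" using \<sigma> \<eta> by simp
  \<comment> \<open>The order of choices matters: \<open>N\<close> for the grid error,
    \<open>L\<close> for the boundary error, which grows with \<open>N\<close>, and last
    \<open>n\<close> against \<open>R = N * L\<close>.\<close>
  obtain N where N: "2 * B * exp \<epsilon> / (\<sigma> * \<eta> / 8) < real N"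
    using reals_Archimedean2 by blast
  then have "0 < real N" using B_pos s\<eta> by (smt (verit) divide_pos_pos exp_gt_zero mult_pos_pos)
  then have N0: "0 < N" by simp
  have errN: "2 * B * exp \<epsilon> / N < \<sigma> * \<eta> / 8"
    using N s\<eta> N0 by (simp add: field_simps)
  obtain L where L: "2 * B * (real N + 1) * (1 + \<sigma>) / (\<sigma> * \<eta> / 8) < real L"
    using reals_Archimedean2 by blast
  then have "0 < real L" using B_pos s\<eta> \<sigma>
    by (smt (verit) divide_nonneg_pos mult_nonneg_nonneg of_nat_0_le_iff)
  then have L0: "0 < L" by simp
  have "2 * B * (real N + 1) * ((1 + V) / L) \<le> 2 * B * (real N + 1) * ((1 + \<sigma>) / L)"
    using V B_pos by (intro mult_left_mono divide_right_mono) auto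
  also have "\<dots> < \<sigma> * \<eta> / 8"
    using L s\<eta> L0 by (simp add: field_simps)
  finally have errL: "2 * B * (real N + 1) * ((1 + V) / L) < \<sigma> * \<eta> / 8" .
  define R where "R = N * L"
  define \<theta> where "\<theta> n = 2 * (real R)\<^sup>2 / real n" for n
  \<comment> \<open>For \<open>\<theta> n \<le> 1\<close> the excess in the second moment is at most
    \<open>\<theta> n * (\<sigma> + 2)\<close>, which must stay below
    \<open>\<sigma> * \<eta> / 2\<close>.\<close>
  define \<theta>0 where "\<theta>0 = min 1 (\<sigma> * \<eta> / (2 * (\<sigma> + 2)))"
  have \<theta>0: "0 < \<theta>0" using \<sigma> \<eta> by (simp add: \<theta>0_def)
  have "\<theta> \<longlonglongrightarrow> 0" unfolding \<theta>_def by real_asymp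
  then have "\<forall>\<^sub>F n in sequentially. \<theta> n < \<theta>0" using \<theta>0 by (rule order_tendstoD)
  then show ?thesis using eventually_ge_at_top[of "R + 1"]
  proof (eventually_elim, intro ballI allI impI)
    fix n :: nat and nbr F
    assume small: "\<theta> n < \<theta>0" and n: "R + 1 \<le> n"
      and nbr: "nbr \<in> {swap_neighbors, add_remove_neighbors}"
      and est: "estimator X F" and dp: "diff_private nbr \<epsilon> X F"
    show "ennreal (sigma_sq \<epsilon> * (1 - \<eta>)) \<le> risk X F f n"
    proof (rule ccontr)
      assume "\<not> ?thesis"
      then have less: "risk X F f n \<le> ennreal (\<sigma> * (1 - \<eta>))" by (simp add: \<sigma>_def)
      \<comment> \<open>Swaps need a constant total, additions a constant number of zeros. Truncated
        subtraction keeps the size at least \<open>n\<close> even for counts outside the box, so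
        that every \<open>P k\<close> is a law.\<close>
      define zeros where "zeros k = (if nbr = swap_neighbors then n - size (profile N k) else n)" for k
      define D where "D k = profile N k + replicate_mset (zeros k) 0" for k
      define P where "P k = F (image_mset e (D k))" for k
      have D_ge: "image_mset e (D k) \<in> datasets_ge X n" for k
      proof -
        have "set_mset (D k) \<subseteq> {0..1}"
          using set_mset_profile[of N k] by (auto simp: D_def)
        then have "set_mset (image_mset e (D k)) \<subseteq> X" using e(2) by auto
        then show ?thesis by (auto simp: datasets_ge_def D_def zeros_def)
      qed
      have D_in: "image_mset e (D k) \<in> datasets X" for k
        using n D_ge[of k] by (simp add: datasets_def datasets_ge_def)
      have P: "prob_space (P k)" "sets (P k) = sets borel" for k
        using est D_in by (auto simp: estimator_def P_def)
      have nbrs: "nbr (image_mset e (D k)) (image_mset e (D (k(j := Suc (k j))))) \<and>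
          nbr (image_mset e (D (k(j := Suc (k j))))) (image_mset e (D k))"
        if k: "k \<in> count_box N L" and j: "j \<in> {1..N}" and kj: "Suc (k j) < L" for k j
      proof (cases "nbr = swap_neighbors")
        case True
        have "size (profile N k) \<le> R" using size_profile_le[OF k] by (simp add: R_def)
        \<comment> \<open>Since \<open>R < n\<close>, at least one zero is left to be exchanged for
          the new record, which differs from it because \<open>j \<ge> 1\<close>.\<close>
        then obtain z where z: "n - size (profile N k) = Suc z"
          using n by (metis Suc_diff_Suc Suc_eq_plus1 le_imp_less_Suc less_le_trans)
        then have "n - Suc (size (profile N k)) = z" by simp
        moreover have "e 0 \<noteq> e (sqrt (real j / N))" "e (sqrt (real j / N)) \<noteq> e 0"
          using e(1) j by (auto simp: inj_eq)
        ultimately show ?thesis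
          using True z profile_update[OF j, of k]
          by (auto simp: D_def zeros_def intro!: swap_neighbors_add)
      next
        case False
        then have "nbr = add_remove_neighbors" using nbr by auto
        then show ?thesis
          using False profile_update[OF j, of k] by (simp add: D_def zeros_def add_remove_neighbors_add)
      qed
      have bound: "sigma_sq \<epsilon> - (2 * B * exp \<epsilon> / N + 2 * B * (real N + 1) * ((1 + V) / L)) \<le> V"
      proof (rule family_bound[OF N0 L0 V(1) P, where \<alpha> = "real n"])
        fix k j and S :: "real set"
        assume "k \<in> count_box N L" "j \<in> {1..N}" "Suc (k j) < L" "S \<in> sets borel"
        then show "measure (P k) S \<le> exp \<epsilon> * measure (P (k(j := Suc (k j)))) S \<and>
            measure (P (k(j := Suc (k j)))) S \<le> exp \<epsilon> * measure (P k) S"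
          using nbrs[of k j] dp D_in unfolding diff_private_def P_def by blast
      next
        fix k assume k: "k \<in> count_box N L"
        interpret Pk: prob_space "P k" by (rule P)
        have [measurable_cong]: "sets (P k) = sets borel" by (rule P)
        define t m where "t = dataset_var (D k)" and "m = size (D k)"
        have sz: "size (profile N k) \<le> R" using size_profile_le[OF k] by (simp add: R_def)
        have nm: "n \<le> m" by (auto simp add: m_def D_def zeros_def)
        have close: "\<bar>real n * t - weight N k\<bar> \<le> \<theta> n"
          unfolding t_def D_def \<theta>_def
          by (rule dataset_var_profile) (use n sz in \<open>auto simp: zeros_def\<close>)
        have \<theta>n: "0 \<le> \<theta> n" by (simp add: \<theta>_def)
        have "risk_at F f (image_mset e (D k)) \<le> risk X F f n"
          unfolding risk_def by (rule SUP_upper) (rule D_ge)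
        then have "ennreal ((real m)\<^sup>2) * (\<integral>\<^sup>+z. ennreal ((z - t)\<^sup>2) \<partial>P k) \<le> ennreal (\<sigma> * (1 - \<eta>))"
          using less unfolding risk_at_def P_def f t_def m_def by simp
        \<comment> \<open>Lowering the factor from the actual size \<open>m\<close> to
          \<open>n\<close> gives all datasets the common scale \<open>\<alpha> = n\<close>.\<close>
        moreover have "ennreal ((real n)\<^sup>2) * (\<integral>\<^sup>+z. ennreal ((z - t)\<^sup>2) \<partial>P k)
            \<le> ennreal ((real m)\<^sup>2) * (\<integral>\<^sup>+z. ennreal ((z - t)\<^sup>2) \<partial>P k)"
          using nm by (intro mult_right_mono ennreal_leI power_mono) auto
        ultimately have mse: "ennreal ((real n)\<^sup>2) * (\<integral>\<^sup>+z. ennreal ((z - t)\<^sup>2) \<partial>P k) \<le> ennreal (\<sigma> * (1 - \<eta>))"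
          by (rule order_trans[rotated])
        have "(\<integral>\<^sup>+z. ennreal ((real n * z - weight N k)\<^sup>2) \<partial>P k)
            \<le> (\<integral>\<^sup>+z. ennreal (1 + \<theta> n) * (ennreal ((real n)\<^sup>2) * ennreal ((z - t)\<^sup>2)) + ennreal (\<theta> n + (\<theta> n)\<^sup>2) \<partial>P k)"
        proof (rule nn_integral_mono)
          fix z
          define a b where "a = real n * (z - t)" and "b = real n * t - weight N k"
          have b: "b\<^sup>2 \<le> (\<theta> n)\<^sup>2" using close by (simp add: b_def abs_le_square_iff[symmetric] \<theta>n)
          \<comment> \<open>Splits the cross term by \<open>\<bar>b\<bar> \<le> \<theta> n\<close>
            and \<open>2 * \<bar>a\<bar> \<le> a\<^sup>2 + 1\<close>.\<close>
          have "2 * (a * b) \<le> \<theta> n * a\<^sup>2 + \<theta> n"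
          proof -
            have "2 * (a * b) \<le> 2 * (\<bar>a\<bar> * \<theta> n)"
              using close by (simp add: b_def[symmetric]) (metis abs_ge_self abs_ge_zero abs_mult mult_left_mono order_trans)
            also have "\<dots> \<le> (a\<^sup>2 + 1) * \<theta> n"
              using sum_squares_bound[of "\<bar>a\<bar>" 1] mult_right_mono[of "2 * \<bar>a\<bar>" "a\<^sup>2 + 1" "\<theta> n"] \<theta>n by simp
            finally show ?thesis by (simp add: algebra_simps)
          qed
          with b have "(a + b)\<^sup>2 \<le> (1 + \<theta> n) * a\<^sup>2 + (\<theta> n + (\<theta> n)\<^sup>2)"
            by (simp add: power2_sum algebra_simps)
          moreover have "a + b = real n * z - weight N k" by (simp add: a_def b_def algebra_simps)
          moreover have "a\<^sup>2 = (real n)\<^sup>2 * (z - t)\<^sup>2" by (simp add: a_def power_mult_distrib)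
          ultimately have "ennreal ((real n * z - weight N k)\<^sup>2) \<le> ennreal ((1 + \<theta> n) * ((real n)\<^sup>2 * (z - t)\<^sup>2) + (\<theta> n + (\<theta> n)\<^sup>2))"
            by (intro ennreal_leI) simp
          then show "ennreal ((real n * z - weight N k)\<^sup>2)
              \<le> ennreal (1 + \<theta> n) * (ennreal ((real n)\<^sup>2) * ennreal ((z - t)\<^sup>2)) + ennreal (\<theta> n + (\<theta> n)\<^sup>2)"
            using \<theta>n by (simp add: ennreal_plus ennreal_mult del: ennreal_plus[symmetric])
        qed
        also have "\<dots> = ennreal (1 + \<theta> n) * (ennreal ((real n)\<^sup>2) * (\<integral>\<^sup>+z. ennreal ((z - t)\<^sup>2) \<partial>P k)) + ennreal (\<theta> n + (\<theta> n)\<^sup>2)"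
          by (simp add: nn_integral_add nn_integral_cmult Pk.emeasure_space_1)
        also have "\<dots> \<le> ennreal (1 + \<theta> n) * ennreal (\<sigma> * (1 - \<eta>)) + ennreal (\<theta> n + (\<theta> n)\<^sup>2)"
          using mse by (intro add_mono mult_left_mono) auto
        also have "\<dots> = ennreal ((1 + \<theta> n) * (\<sigma> * (1 - \<eta>)) + (\<theta> n + (\<theta> n)\<^sup>2))"
          using \<theta>n \<sigma> \<eta> by (simp add: ennreal_mult)
        also have "\<dots> \<le> ennreal V"
        proof (rule ennreal_leI)
          have "\<theta> n \<le> 1" "\<theta> n \<le> \<sigma> * \<eta> / (2 * (\<sigma> + 2))" using small by (auto simp: \<theta>0_def)
          then have "(\<theta> n)\<^sup>2 \<le> \<theta> n" "\<theta> n * (\<sigma> + 2) \<le> \<sigma> * \<eta> / 2"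
            using \<theta>n \<sigma> by (auto simp: power2_eq_square field_simps mult_left_le)
          moreover have "\<theta> n * (\<sigma> * (1 - \<eta>)) \<le> \<theta> n * \<sigma>"
            using \<theta>n \<sigma> \<eta> by (intro mult_left_mono) auto
          ultimately show "(1 + \<theta> n) * (\<sigma> * (1 - \<eta>)) + (\<theta> n + (\<theta> n)\<^sup>2) \<le> V"
            by (simp add: V_def algebra_simps)
        qed
        finally show "(\<integral>\<^sup>+z. ennreal ((real n * z - weight N k)\<^sup>2) \<partial>P k) \<le> ennreal V" .
      qed
      show False
      proof -
        have "V = \<sigma> - 4 * (\<sigma> * \<eta> / 8)" by (simp add: V_def algebra_simps)
        with bound show ?thesis
          using errN errL s\<eta> unfolding \<sigma>_def[symmetric] by linarith
      qed
    qed
  qed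
qed

end

theorem theorem1:
  "(\<forall>\<epsilon>>0.
      (\<exists>\<delta> :: nat \<Rightarrow> real. \<delta> \<longlonglongrightarrow> 0 \<and>
        (\<forall>nbr\<in>{swap_neighbors, add_remove_neighbors}. \<forall>F n0.
           1 \<le> n0 \<longrightarrow> estimator ({0..1} \<times> {0..1}) F \<longrightarrow>
           diff_private nbr \<epsilon> ({0..1} \<times> {0..1}) F \<longrightarrow>
           risk ({0..1} \<times> {0..1}) F dataset_cov n0 \<ge> ennreal (sigma_sq \<epsilon> * (1 - \<delta> n0)))) \<and>
      (\<exists>\<delta> :: nat \<Rightarrow> real. \<delta> \<longlonglongrightarrow> 0 \<and>
        (\<forall>nbr\<in>{swap_neighbors, add_remove_neighbors}. \<forall>F n0.
           1 \<le> n0 \<longrightarrow> estimator {0..1} F \<longrightarrow>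
           diff_private nbr \<epsilon> {0..1} F \<longrightarrow>
           risk {0..1} F dataset_var n0 \<ge> ennreal (sigma_sq \<epsilon> * (1 - \<delta> n0))))) \<and>
   sigma_sq \<sim>[at_right 0] (\<lambda>\<epsilon>. 2 / \<epsilon>\<^sup>2) \<and>
   ((\<lambda>\<epsilon>. \<epsilon>\<^sup>2 * sigma_sq \<epsilon> / 2) \<longlongrightarrow> 1) (at_right 0)"
proof (intro conjI allI impI sigma_sq_asymp_equiv sigma_sq_tendsto)
  fix \<epsilon> :: real assume "0 < \<epsilon>"
  then interpret staircase \<epsilon> by unfold_locales
  \<comment> \<open>The quantifiers over \<open>nbr\<close> and \<open>F\<close> belong to the
    predicate given to \<open>ex_rate\<close>, so one \<open>\<delta>\<close> serves all estimators;
    at \<open>\<eta> = 1\<close> the bound is 0.\<close>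
  have rate: "\<exists>\<delta>. \<delta> \<longlonglongrightarrow> 0 \<and> (\<forall>n. \<forall>nbr\<in>{swap_neighbors, add_remove_neighbors}. \<forall>F.
      estimator X F \<longrightarrow> diff_private nbr \<epsilon> X F \<longrightarrow> ennreal (sigma_sq \<epsilon> * (1 - \<delta> n)) \<le> risk X F f n)"
    if "inj e" "e ` {0..1} \<subseteq> X" "\<And>D. f (image_mset e D) = dataset_var D"
    for e :: "real \<Rightarrow> 'r" and X f
    by (rule ex_rate) (simp, rule eventually_risk_ge[OF that])
  show "\<exists>\<delta> :: nat \<Rightarrow> real. \<delta> \<longlonglongrightarrow> 0 \<and>
        (\<forall>nbr\<in>{swap_neighbors, add_remove_neighbors}. \<forall>F n0.
           1 \<le> n0 \<longrightarrow> estimator ({0..1} \<times> {0..1}) F \<longrightarrow>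
           diff_private nbr \<epsilon> ({0..1} \<times> {0..1}) F \<longrightarrow>
           risk ({0..1} \<times> {0..1}) F dataset_cov n0 \<ge> ennreal (sigma_sq \<epsilon> * (1 - \<delta> n0)))"
    using rate[of "\<lambda>x. (x, x)" "{0..1} \<times> {0..1}" dataset_cov] dataset_cov_diagonal
    by (force simp: inj_on_def)
  show "\<exists>\<delta> :: nat \<Rightarrow> real. \<delta> \<longlonglongrightarrow> 0 \<and>
        (\<forall>nbr\<in>{swap_neighbors, add_remove_neighbors}. \<forall>F n0.
           1 \<le> n0 \<longrightarrow> estimator {0..1} F \<longrightarrow>
           diff_private nbr \<epsilon> {0..1} F \<longrightarrow>
           risk {0..1} F dataset_var n0 \<ge> ennreal (sigma_sq \<epsilon> * (1 - \<delta> n0)))"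
    using rate[of "\<lambda>x. x" "{0..1}" dataset_var] by force
qed

end
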